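(* Let $\pi$ be a factor code from an irreducible shift of finite type $X$ onto a sofic shift $Y$. Then the following are equivalent: $\pi$ is right class-closing and left continuing; $\pi$ is left class-closing and right continuing; $\pi$ is constant-class-to-one.
   Context: Shift spaces are closed shift-invariant subsets of $\mathcal{A}^{\mathbb{Z}}$ for a finite alphabet $\mathcal{A}$; $\mathcal{B}(X)$ is the set of words occurring in points of $X$; $X$ is irreducible if for all $u,v\in\mathcal{B}(X)$ there is $w$ with $uwv\in\mathcal{B}(X)$. $X$ is a shift of finite type if for some $k\ge 0$ every $w\in\mathcal{B}(X)$ of length $k$ satisfies: $uw,wv\in\mathcal{B}(X)$ implies $uwv\in\mathcal{B}(X)$. A factor code is a continuous shift-commuting surjection; a sofic shift is a factor of a shift of finite type. Two points $x,x'$ are left (resp. right) asymptotic if $x|_{(-\infty,n]}=x'|_{(-\infty,n]}$ (resp. $x|_{[n,\infty)}=x'|_{[n,\infty)}$) for some $n\in\mathbb{Z}$. Let $x,x'\in X$ with $\pi(x)=\pi(x')$ and $m\in\mathbb{Z}$. A right $m$-bridge from $x$ to $x'$ is a point $z\in X$ with $\pi(z)=\pi(x)$ such that for some $n>m$, $z|_{(-\infty,m]}=x|_{(-\infty,m]}$ and $z|_{[n,\infty)}=x'|_{[n,\infty)}$. A left $m$-bridge from $x$ to $x'$ is a point $z\in X$ with $\pi(z)=\pi(x)$ such that for some $n<m$, $z|_{(-\infty,n]}=x'|_{(-\infty,n]}$ and $z|_{[m,\infty)}=x|_{[m,\infty)}$. Write $x\to^r x'$ (resp. $x\to^l x'$)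 if for every $m\in\mathbb{Z}$ there is a right (resp. left) $m$-bridge from $x$ to $x'$. Points $x,x'$ in the same fibre are right equivalent if $x\to^r x'$ and $x'\to^r x$, and left equivalent if $x\to^l x'$ and $x'\to^l x$. $\pi$ is right (resp. left) class-closing if any two left (resp. right) asymptotic points $x,x'\in X$ with $\pi(x)=\pi(x')$ are right (resp. left) equivalent. $\pi$ is right (resp. left) continuing if for all $x\in X$ and all $y\in Y$ left (resp. right) asymptotic to $\pi(x)$ there is a preimage of $y$ under $\pi$ that is left (resp. right) asymptotic to $x$. For $y\in Y$, $d_\pi^r(y)$ is the number of right equivalence classes in $\pi^{-1}(y)$ (always finite), and the class degree of $\pi$ is $d_\pi=\min_{y\in Y}d_\pi^r(y)$. $\pi$ is constant-class-to-one if $d_\pi^r(y)=d_\pi$ for all $y\in Y$. *)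

theory Defs
  imports "HOL-Analysis.Analysis"
begin

section \<open>Shift spaces\<close>

text \<open>Points are bi-infinite sequences \<open>int \<Rightarrow> 'a\<close>. The alphabet is an explicit finite set
  \<open>A\<close> of symbols, so that the definition of sofic shifts can quantify over the alphabet of
  the covering shift of finite type.\<close>

definition full_shift_topology :: "'a set \<Rightarrow> (int \<Rightarrow> 'a) topology" where
  "full_shift_topology A = product_topology (\<lambda>_. discrete_topology A) UNIV"

definition shift :: "(int \<Rightarrow> 'a) \<Rightarrow> int \<Rightarrow> 'a" where
  "shift x = (\<lambda>i. x (i + 1))"

text \<open>The inclusion in \<open>A\<close>-valued sequences is part of \<^const>\<open>closedin\<close>; the empty set counts as
  a shift space.\<close>

definition shift_space :: "'a set \<Rightarrow> (int \<Rightarrow> 'a) set \<Rightarrow> bool" where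
  "shift_space A X \<longleftrightarrow>
     finite A \<and> closedin (full_shift_topology A) X \<and> shift ` X = X"

definition language :: "(int \<Rightarrow> 'a) set \<Rightarrow> 'a list set" where
  "language X = {map (\<lambda>j. x (i + int j)) [0..<n] |x i n. x \<in> X}"

definition irreducible_shift :: "(int \<Rightarrow> 'a) set \<Rightarrow> bool" where
  "irreducible_shift X \<longleftrightarrow>
     (\<forall>u\<in>language X. \<forall>v\<in>language X. \<exists>w. u @ w @ v \<in> language X)"

definition shift_of_finite_type :: "'a set \<Rightarrow> (int \<Rightarrow> 'a) set \<Rightarrow> bool" where
  "shift_of_finite_type A X \<longleftrightarrow> shift_space A X \<and>
     (\<exists>k. \<forall>w\<in>language X. length w = k \<longrightarrow>
        (\<forall>u v. u @ w \<in> language X \<and> w @ v \<in> language X \<longrightarrow> u @ w @ v \<in> language X))"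

text \<open>Only the values of \<open>\<pi>\<close> on \<open>X\<close> matter.\<close>

definition factor_code ::
  "'a set \<Rightarrow> (int \<Rightarrow> 'a) set \<Rightarrow> 'b set \<Rightarrow> (int \<Rightarrow> 'b) set \<Rightarrow>
   ((int \<Rightarrow> 'a) \<Rightarrow> int \<Rightarrow> 'b) \<Rightarrow> bool" where
  "factor_code A X B Y \<pi> \<longleftrightarrow> shift_space A X \<and> shift_space B Y \<and>
     continuous_map (subtopology (full_shift_topology A) X)
                    (subtopology (full_shift_topology B) Y) \<pi> \<and>
     (\<forall>x\<in>X. \<pi> (shift x) = shift (\<pi> x)) \<and>
     \<pi> ` X = Y"

text \<open>A formula cannot quantify over types; since alphabets are finite, every shift of finite
  type is, up to renaming symbols, one over a finite set of natural numbers.\<close>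

definition sofic_shift :: "'b set \<Rightarrow> (int \<Rightarrow> 'b) set \<Rightarrow> bool" where
  "sofic_shift B Y \<longleftrightarrow> shift_space B Y \<and>
     (\<exists>(C :: nat set) Z \<phi>. shift_of_finite_type C Z \<and> factor_code C Z B Y \<phi>)"

section \<open>Asymptotic points, bridges and transition classes\<close>

definition left_asymptotic :: "(int \<Rightarrow> 'a) \<Rightarrow> (int \<Rightarrow> 'a) \<Rightarrow> bool" where
  "left_asymptotic x x' \<longleftrightarrow> (\<exists>n. \<forall>i\<le>n. x i = x' i)"

definition right_asymptotic :: "(int \<Rightarrow> 'a) \<Rightarrow> (int \<Rightarrow> 'a) \<Rightarrow> bool" where
  "right_asymptotic x x' \<longleftrightarrow> (\<exists>n. \<forall>i\<ge>n. x i = x' i)"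

text \<open>In the next definitions \<open>x\<close> and \<open>x'\<close> are meant to be points of \<open>X\<close> with
  \<open>\<pi> x = \<pi> x'\<close>; this is imposed wherever the notions are used.\<close>

definition right_bridge ::
  "(int \<Rightarrow> 'a) set \<Rightarrow> ((int \<Rightarrow> 'a) \<Rightarrow> int \<Rightarrow> 'b) \<Rightarrow> int \<Rightarrow>
   (int \<Rightarrow> 'a) \<Rightarrow> (int \<Rightarrow> 'a) \<Rightarrow> (int \<Rightarrow> 'a) \<Rightarrow> bool" where
  "right_bridge X \<pi> m x x' z \<longleftrightarrow> z \<in> X \<and> \<pi> z = \<pi> x \<and>
     (\<exists>n>m. (\<forall>i\<le>m. z i = x i) \<and> (\<forall>i\<ge>n. z i = x' i))"

definition left_bridge ::
  "(int \<Rightarrow> 'a) set \<Rightarrow> ((int \<Rightarrow> 'a) \<Rightarrow> int \<Rightarrow> 'b) \<Rightarrow> int \<Rightarrow>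
   (int \<Rightarrow> 'a) \<Rightarrow> (int \<Rightarrow> 'a) \<Rightarrow> (int \<Rightarrow> 'a) \<Rightarrow> bool" where
  "left_bridge X \<pi> m x x' z \<longleftrightarrow> z \<in> X \<and> \<pi> z = \<pi> x \<and>
     (\<exists>n<m. (\<forall>i\<le>n. z i = x' i) \<and> (\<forall>i\<ge>m. z i = x i))"

definition right_to ::
  "(int \<Rightarrow> 'a) set \<Rightarrow> ((int \<Rightarrow> 'a) \<Rightarrow> int \<Rightarrow> 'b) \<Rightarrow>
   (int \<Rightarrow> 'a) \<Rightarrow> (int \<Rightarrow> 'a) \<Rightarrow> bool" where
  "right_to X \<pi> x x' \<longleftrightarrow> (\<forall>m. \<exists>z. right_bridge X \<pi> m x x' z)"

definition left_to ::
  "(int \<Rightarrow> 'a) set \<Rightarrow> ((int \<Rightarrow> 'a) \<Rightarrow> int \<Rightarrow> 'b) \<Rightarrow>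
   (int \<Rightarrow> 'a) \<Rightarrow> (int \<Rightarrow> 'a) \<Rightarrow> bool" where
  "left_to X \<pi> x x' \<longleftrightarrow> (\<forall>m. \<exists>z. left_bridge X \<pi> m x x' z)"

definition right_equivalent ::
  "(int \<Rightarrow> 'a) set \<Rightarrow> ((int \<Rightarrow> 'a) \<Rightarrow> int \<Rightarrow> 'b) \<Rightarrow>
   (int \<Rightarrow> 'a) \<Rightarrow> (int \<Rightarrow> 'a) \<Rightarrow> bool" where
  "right_equivalent X \<pi> x x' \<longleftrightarrow> right_to X \<pi> x x' \<and> right_to X \<pi> x' x"

definition left_equivalent ::
  "(int \<Rightarrow> 'a) set \<Rightarrow> ((int \<Rightarrow> 'a) \<Rightarrow> int \<Rightarrow> 'b) \<Rightarrow>
   (int \<Rightarrow> 'a) \<Rightarrow> (int \<Rightarrow> 'a) \<Rightarrow> bool" where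
  "left_equivalent X \<pi> x x' \<longleftrightarrow> left_to X \<pi> x x' \<and> left_to X \<pi> x' x"

section \<open>Class-closing, continuing and constant-class-to-one codes\<close>

definition right_class_closing ::
  "(int \<Rightarrow> 'a) set \<Rightarrow> ((int \<Rightarrow> 'a) \<Rightarrow> int \<Rightarrow> 'b) \<Rightarrow> bool" where
  "right_class_closing X \<pi> \<longleftrightarrow>
     (\<forall>x\<in>X. \<forall>x'\<in>X. left_asymptotic x x' \<and> \<pi> x = \<pi> x' \<longrightarrow> right_equivalent X \<pi> x x')"

definition left_class_closing ::
  "(int \<Rightarrow> 'a) set \<Rightarrow> ((int \<Rightarrow> 'a) \<Rightarrow> int \<Rightarrow> 'b) \<Rightarrow> bool" where
  "left_class_closing X \<pi> \<longleftrightarrow>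
     (\<forall>x\<in>X. \<forall>x'\<in>X. right_asymptotic x x' \<and> \<pi> x = \<pi> x' \<longrightarrow> left_equivalent X \<pi> x x')"

definition right_continuing ::
  "(int \<Rightarrow> 'a) set \<Rightarrow> (int \<Rightarrow> 'b) set \<Rightarrow> ((int \<Rightarrow> 'a) \<Rightarrow> int \<Rightarrow> 'b) \<Rightarrow> bool" where
  "right_continuing X Y \<pi> \<longleftrightarrow>
     (\<forall>x\<in>X. \<forall>y\<in>Y. left_asymptotic y (\<pi> x) \<longrightarrow>
        (\<exists>x'\<in>X. \<pi> x' = y \<and> left_asymptotic x' x))"

definition left_continuing ::
  "(int \<Rightarrow> 'a) set \<Rightarrow> (int \<Rightarrow> 'b) set \<Rightarrow> ((int \<Rightarrow> 'a) \<Rightarrow> int \<Rightarrow> 'b) \<Rightarrow> bool" where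
  "left_continuing X Y \<pi> \<longleftrightarrow>
     (\<forall>x\<in>X. \<forall>y\<in>Y. right_asymptotic y (\<pi> x) \<longrightarrow>
        (\<exists>x'\<in>X. \<pi> x' = y \<and> right_asymptotic x' x))"

definition fibre ::
  "(int \<Rightarrow> 'a) set \<Rightarrow> ((int \<Rightarrow> 'a) \<Rightarrow> int \<Rightarrow> 'b) \<Rightarrow> (int \<Rightarrow> 'b) \<Rightarrow> (int \<Rightarrow> 'a) set" where
  "fibre X \<pi> y = {x \<in> X. \<pi> x = y}"

definition right_classes ::
  "(int \<Rightarrow> 'a) set \<Rightarrow> ((int \<Rightarrow> 'a) \<Rightarrow> int \<Rightarrow> 'b) \<Rightarrow> (int \<Rightarrow> 'b) \<Rightarrow> (int \<Rightarrow> 'a) set set" where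
  "right_classes X \<pi> y =
     fibre X \<pi> y // {(x, x'). x \<in> fibre X \<pi> y \<and> x' \<in> fibre X \<pi> y \<and> right_equivalent X \<pi> x x'}"

text \<open>For a factor code on a shift of finite type there are only finitely many right classes in a
  fibre, so \<^const>\<open>card\<close> is the true number of classes.\<close>

definition num_right_classes ::
  "(int \<Rightarrow> 'a) set \<Rightarrow> ((int \<Rightarrow> 'a) \<Rightarrow> int \<Rightarrow> 'b) \<Rightarrow> (int \<Rightarrow> 'b) \<Rightarrow> nat" where
  "num_right_classes X \<pi> y = card (right_classes X \<pi> y)"

text \<open>On \<^typ>\<open>nat\<close>, the infimum of a nonempty set is its minimum; the set need not be known to
  be finite, unlike for \<^const>\<open>Min\<close>.\<close>

definition class_degree ::
  "(int \<Rightarrow> 'a) set \<Rightarrow> (int \<Rightarrow> 'b) set \<Rightarrow> ((int \<Rightarrow> 'a) \<Rightarrow> int \<Rightarrow> 'b) \<Rightarrow> nat" where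
  "class_degree X Y \<pi> = (INF y\<in>Y. num_right_classes X \<pi> y)"

definition constant_class_to_one ::
  "(int \<Rightarrow> 'a) set \<Rightarrow> (int \<Rightarrow> 'b) set \<Rightarrow> ((int \<Rightarrow> 'a) \<Rightarrow> int \<Rightarrow> 'b) \<Rightarrow> bool" where
  "constant_class_to_one X Y \<pi> \<longleftrightarrow>
     (\<forall>y\<in>Y. num_right_classes X \<pi> y = class_degree X Y \<pi>)"

end

theory Submission
  imports Defs
begin

text \<open>All three conditions are equivalent to a fourth one that does not distinguish left from right:
  every point of \<open>Y\<close> contains a \<^emph>\<open>minimal transition block\<close>.

  \<^bold>\<open>States.\<close> Let the state of \<open>x\<close> at time \<open>a\<close> be its restriction to \<open>[a - N, a + N]\<close>. If \<open>N\<close> is large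
  compared with the memory of \<open>X\<close> and the radius of \<open>\<pi>\<close>, two points with equal states at \<open>a\<close> may be
  spliced at \<open>a\<close>: the result lies in \<open>X\<close> and its image follows the image of the one point up to \<open>a\<close>
  and of the other from \<open>a\<close> on. So everything can be read off from the relations
  \<open>reach y a b s t\<close>: some point lies over \<open>y\<close> on \<open>[a, b]\<close> and leads from state \<open>s\<close> to state \<open>t\<close>.

  \<^bold>\<open>Blocks and classes.\<close> A transition block in \<open>y\<close> consists of an interval \<open>[a, b]\<close>, a time \<open>n\<close> in it and
  a set \<open>M\<close> of states such that every passage over \<open>y\<close> through \<open>[a, b]\<close> can be rerouted, with the same
  end states, through \<open>M\<close> at time \<open>n\<close>. If such blocks with at most \<open>D\<close> states occur arbitrarily far to
  the right, the pigeonhole principle merges any \<open>D + 1\<close> points of the fibre into at most \<open>D\<close> right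
  classes (\<open>right_classes_le_block_size\<close>). Conversely, compactness turns a system of representatives of
  the right classes into a transition block with that many states
  (\<open>tblock_of_class_representatives\<close>). Hence the class degree is the least possible size of \<open>M\<close>, and
  \<open>\<pi>\<close> is constant-class-to-one iff minimal blocks occur in every point.

  \<^bold>\<open>Rigidity.\<close> Between two disjoint minimal blocks in the same point, reachability is a bijection from \<open>M\<close>
  to \<open>M'\<close> (\<open>mblock_reach_bijective\<close>). Minimality says that no state of \<open>M\<close> can be spared. The relations
  on \<open>M\<close> given by successive occurrences of one block therefore form a finite semigroup in which every
  \<open>r\<close> is the only intermediate state for some pair; this makes idempotents partial orders.
  Irreducibility provides relations leading from any state to any other, which excludes strict
  comparabilities, so idempotents are identities and all these relations are permutations.

  \<^bold>\<open>Conclusion.\<close> If minimal blocks are everywhere, two left asymptotic points of a fibre leave a block far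
  to the left in the same state of \<open>M\<close>, so they can pass a block far to the right in the same state of
  \<open>M'\<close>; this gives bridges, and \<open>\<pi>\<close> is right class-closing. Following the bijections leftwards from a
  given point and taking a limit shows that \<open>\<pi>\<close> is left continuing. Conversely, let \<open>\<pi>\<close> be right
  class-closing and left continuing. Change \<open>y\<close> far to the left so that a minimal block appears, and
  lift inequivalent points of the fibre of \<open>y\<close> accordingly. If there were more of them than the class
  degree, two could be rerouted through the same state of the block; splicing them there and
  right class-closing would make them equivalent. Finally, reversing time preserves minimal blocks and
  exchanges the two one-sided conditions.\<close>

section \<open>Idempotents in semigroups of relations\<close>

text \<open>Two powers agree by finiteness, so the powers are eventually periodic; at a multiple of the
  period beyond the start of periodicity, doubling the exponent changes nothing.\<close>

lemma relpow_idempotent_exists: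
  fixes G :: "('a \<times> 'a) set"
  assumes "finite M" "G \<subseteq> M \<times> M"
  shows "\<exists>k>0. (G ^^ k) O (G ^^ k) = G ^^ k"
proof -
  have sub: "G ^^ Suc k \<subseteq> M \<times> M" for k
    using assms(2) by (induction k) auto
  have "finite (Pow (M \<times> M))" using assms(1) by simp
  moreover have "range (\<lambda>k. G ^^ Suc k) \<subseteq> Pow (M \<times> M)" using sub by (intro image_subsetI PowI)
  ultimately have "finite (range (\<lambda>k. G ^^ Suc k))" by (rule rev_finite_subset)
  then have "\<not> inj (\<lambda>k. G ^^ Suc k)"
    using range_inj_infinite by metis
  then obtain i' j' where ij': "i' \<noteq> j'" "G ^^ Suc i' = G ^^ Suc j'"
    unfolding inj_def by metis
  obtain i j where ij: "0 < i" "i < j" "G ^^ i = G ^^ j"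
  proof (cases "i' < j'")
    case True
    with ij' show ?thesis by (intro that[of "Suc i'" "Suc j'"]) simp_all
  next
    case False
    with ij' show ?thesis by (intro that[of "Suc j'" "Suc i'"]) simp_all
  qed
  define p where "p = j - i"
  have p: "p > 0" "j = i + p" using ij(2) unfolding p_def by simp_all
  have step: "G ^^ (m + p) = G ^^ m" if m: "m \<ge> i" for m
  proof -
    obtain q where q: "m = i + q" using le_Suc_ex[OF m] by blast
    have "m + p = j + q" using q p(2) by simp
    then have "G ^^ (m + p) = G ^^ j O G ^^ q" by (simp only: relpow_add)
    also have "\<dots> = G ^^ m" by (simp only: q relpow_add ij(3))
    finally show ?thesis .
  qed
  have steps: "G ^^ (m + l * p) = G ^^ m" if "m \<ge> i" for m l
  proof (induction l)
    case (Suc l)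
    have "m + Suc l * p = m + l * p + p" by simp
    then have "G ^^ (m + Suc l * p) = G ^^ (m + l * p + p)" by (rule arg_cong)
    also have "\<dots> = G ^^ (m + l * p)" using that by (intro step) simp
    finally show ?case using Suc by simp
  qed simp
  have "i * p \<ge> i" using p(1) by simp
  then have "G ^^ (i * p + i * p) = G ^^ (i * p)" by (rule steps)
  then show ?thesis
    using ij(1) p(1) by (intro exI[of _ "i * p"]) (simp only: relpow_add, simp)
qed

text \<open>The axiom \<open>bottleneck\<close> is what minimality of a transition block says about two consecutive
  return relations: if \<open>r\<close> could always be bypassed, the block would still work without \<open>r\<close>.\<close>

locale minimal_relation_semigroup =
  fixes M :: "'a set" and S :: "('a \<times> 'a) set set"
  assumes finite_M: "finite M"
    and on_M: "G \<in> S \<Longrightarrow> G \<subseteq> M \<times> M"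
    and comp_closed: "G \<in> S \<Longrightarrow> H \<in> S \<Longrightarrow> G O H \<in> S"
    and bottleneck: "G \<in> S \<Longrightarrow> H \<in> S \<Longrightarrow> r \<in> M \<Longrightarrow>
      \<exists>s t. (s, r) \<in> G \<and> (r, t) \<in> H \<and> (\<forall>r'. (s, r') \<in> G \<and> (r', t) \<in> H \<longrightarrow> r' = r)"
    and transitive: "s \<in> M \<Longrightarrow> t \<in> M \<Longrightarrow> \<exists>G\<in>S. (s, t) \<in> G"
begin

text \<open>By idempotence the passage from \<open>s\<close> to \<open>r\<close> splits as \<open>s \<rightarrow> x \<rightarrow> r\<close>, and \<open>x\<close> leads on to \<open>t\<close>
  through \<open>r\<close>. As \<open>r\<close> is the only state between \<open>s\<close> and \<open>t\<close>, this \<open>x\<close> is \<open>r\<close>.\<close>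

lemma idempotent_refl:
  assumes "E \<in> S" "E O E = E" "r \<in> M"
  shows "(r, r) \<in> E"
proof -
  obtain s t where st: "(s, r) \<in> E" "(r, t) \<in> E"
    "\<And>r'. (s, r') \<in> E \<Longrightarrow> (r', t) \<in> E \<Longrightarrow> r' = r"
    using bottleneck[OF assms(1,1,3)] by blast
  obtain x where x: "(s, x) \<in> E" "(x, r) \<in> E" using st(1) assms(2) by blast
  have "(x, t) \<in> E" using x(2) st(2) assms(2) by blast
  then show ?thesis using st(3) x by blast
qed

lemma idempotent_antisym:
  assumes "E \<in> S" "E O E = E" "(x, r) \<in> E" "(r, x) \<in> E"
  shows "x = r"
proof -
  have "r \<in> M" using on_M[OF assms(1)] assms(3) by blast
  then obtain s t where st: "(s, r) \<in> E" "(r, t) \<in> E"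
    "\<And>r'. (s, r') \<in> E \<Longrightarrow> (r', t) \<in> E \<Longrightarrow> r' = r"
    using bottleneck[OF assms(1,1)] by blast
  have "(s, x) \<in> E" "(x, t) \<in> E" using st assms by blast+
  then show ?thesis using st(3) by blast
qed

lemma relpow_closed: "G \<in> S \<Longrightarrow> G ^^ Suc k \<in> S"
  by (induction k) (auto intro: comp_closed)

text \<open>\<open>E\<close> is a partial order. If \<open>x < y\<close>, pick \<open>U\<close> leading back from \<open>y\<close> to \<open>x\<close>. An idempotent power
  of \<open>E O U O E\<close> is again a partial order, but it contains both \<open>(x, y)\<close> and \<open>(y, x)\<close>.\<close>

lemma idempotent_eq_Id_on:
  assumes E: "E \<in> S" "E O E = E"
  shows "E = Id_on M"
proof (rule ccontr)
  assume "E \<noteq> Id_on M"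
  moreover have "Id_on M \<subseteq> E" using idempotent_refl[OF E] by auto
  ultimately obtain x y where xy: "(x, y) \<in> E" "x \<noteq> y"
    using on_M[OF E(1)] by (fastforce simp: Id_on_iff)
  have M: "x \<in> M" "y \<in> M" using xy(1) on_M[OF E(1)] by auto
  obtain U where U: "U \<in> S" "(y, x) \<in> U" using transitive M by blast
  define F where "F = E O U O E"
  have F: "F \<in> S" unfolding F_def using E U by (intro comp_closed)
  have EF: "E O F = F" unfolding F_def by (metis E(2) O_assoc)
  obtain k where k: "k > 0" "(F ^^ k) O (F ^^ k) = F ^^ k"
    using relpow_idempotent_exists[OF finite_M on_M[OF F]] by blast
  obtain l where l: "k = Suc l" using k(1) gr0_implies_Suc by blast
  have FkS: "F ^^ k \<in> S" unfolding l by (rule relpow_closed[OF F])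
  have refl: "(x, x) \<in> E" "(y, y) \<in> E" using idempotent_refl[OF E] M by auto
  have xx: "(x, x) \<in> F" and yx: "(y, x) \<in> F"
    unfolding F_def using xy U refl by blast+
  have "(x, x) \<in> F ^^ l" using xx by (induction l) auto
  then have "(y, x) \<in> F ^^ k"
    unfolding l by (rule relpow_Suc_I2[OF yx])
  moreover have "(x, y) \<in> F ^^ k"
  proof -
    have "(y, y) \<in> F ^^ k" using idempotent_refl[OF FkS k(2)] M by blast
    then obtain u where u: "(y, u) \<in> F" "(u, y) \<in> F ^^ l"
      unfolding l by (meson relpow_Suc_D2)
    have "(x, u) \<in> F" using u(1) xy(1) EF by blast
    then show ?thesis unfolding l using u(2) by (rule relpow_Suc_I2)
  qed
  ultimately have "x = y" using idempotent_antisym[OF FkS k(2)] by blast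
  then show False using xy(2) by simp
qed

text \<open>Some power of \<open>G\<close> is the identity, so a smaller power inverts \<open>G\<close>.\<close>

lemma relation_bijective:
  assumes G: "G \<in> S"
  shows "(a, b) \<in> G \<Longrightarrow> (a, c) \<in> G \<Longrightarrow> b = c"
    and "(a, c) \<in> G \<Longrightarrow> (b, c) \<in> G \<Longrightarrow> a = b"
proof -
  obtain k where k: "k > 0" "(G ^^ k) O (G ^^ k) = G ^^ k"
    using relpow_idempotent_exists[OF finite_M on_M[OF G]] by blast
  obtain l where l: "k = Suc l" using k(1) gr0_implies_Suc by blast
  have Gk: "G ^^ Suc l = Id_on M"
    using idempotent_eq_Id_on k relpow_closed[OF G] unfolding l by blast
  have inv: "(b, a) \<in> G ^^ l" if "(a, b) \<in> G" for a b
  proof -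
    have "a \<in> M" using that on_M[OF G] by auto
    then have "(a, a) \<in> G ^^ Suc l" using Gk by (simp add: Id_on_iff)
    then obtain c where c: "(a, c) \<in> G" "(c, a) \<in> G ^^ l" by (meson relpow_Suc_D2)
    have "b \<in> M" using that on_M[OF G] by auto
    then have "(b, b) \<in> G ^^ Suc l" using Gk by (simp add: Id_on_iff)
    then obtain e where e: "(b, e) \<in> G ^^ l" "(e, b) \<in> G" by (meson relpow_Suc_E)
    have "(a, e) \<in> G ^^ Suc l" using relpow_Suc_I2[OF that e(1)] .
    then have "a = e" unfolding Gk by (simp add: Id_on_iff)
    then show ?thesis using e by simp
  qed
  show "b = c" if "(a, b) \<in> G" "(a, c) \<in> G"
  proof -
    have "(b, c) \<in> G ^^ Suc l" using inv[OF that(1)] that(2) by auto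
    then show ?thesis unfolding Gk by (simp add: Id_on_iff)
  qed
  show "a = b" if "(a, c) \<in> G" "(b, c) \<in> G"
  proof -
    have "(a, b) \<in> G ^^ Suc l" using relpow_Suc_I2[OF that(1) inv[OF that(2)]] .
    then show ?thesis unfolding Gk by (simp add: Id_on_iff)
  qed
qed

end

section \<open>Codes that behave like one-block codes on one-step shifts\<close>

definition translate :: "int \<Rightarrow> (int \<Rightarrow> 'a) \<Rightarrow> int \<Rightarrow> 'a" where
  "translate c x = (\<lambda>i. x (i + c))"

definition join :: "(int \<Rightarrow> 'a) \<Rightarrow> int \<Rightarrow> (int \<Rightarrow> 'a) \<Rightarrow> int \<Rightarrow> 'a" where
  "join x a x' = (\<lambda>i. if i \<le> a then x i else x' i)"

text \<open>Recoding to a one-step shift and a one-block code is replaced by the window size \<open>N\<close>: the axioms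
  \<open>join_in\<close> and \<open>code_local\<close> express the memory of \<open>X\<close> and the locality of \<open>\<pi>\<close>, \<open>cluster_point\<close>
  expresses compactness and \<open>connect\<close> expresses irreducibility. The axioms are symmetric under
  reversal of time, so that each result also applies to the reflected code.\<close>

locale splicing_code =
  fixes A :: "'a set" and X :: "(int \<Rightarrow> 'a) set"
    and \<pi> :: "(int \<Rightarrow> 'a) \<Rightarrow> int \<Rightarrow> 'b" and N :: int
  assumes finite_alphabet: "finite A"
    and in_alphabet: "x \<in> X \<Longrightarrow> x i \<in> A"
    and nonempty: "X \<noteq> {}"
    and N_nonneg: "N \<ge> 0"
    and cluster_point: "(\<And>k. f k \<in> X) \<Longrightarrow>
      \<exists>z\<in>X. \<forall>n. \<exists>k\<ge>n. \<forall>i. \<bar>i\<bar> \<le> int n \<longrightarrow> f k i = z i"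
    and translate_in: "x \<in> X \<Longrightarrow> translate c x \<in> X"
    and code_translate: "x \<in> X \<Longrightarrow> \<pi> (translate c x) = translate c (\<pi> x)"
    and join_in: "x \<in> X \<Longrightarrow> x' \<in> X \<Longrightarrow> (\<And>i. \<bar>i - a\<bar> \<le> N \<Longrightarrow> x i = x' i) \<Longrightarrow>
      join x a x' \<in> X"
    and code_local: "x \<in> X \<Longrightarrow> x' \<in> X \<Longrightarrow> (\<And>i. \<bar>i - a\<bar> \<le> N \<Longrightarrow> x i = x' i) \<Longrightarrow>
      \<pi> x a = \<pi> x' a"
    and connect: "x \<in> X \<Longrightarrow> x' \<in> X \<Longrightarrow>
      \<exists>z\<in>X. \<exists>c. a < b + c \<and> (\<forall>i\<le>a. z i = x i) \<and> (\<forall>i\<ge>b + c. z i = x' (i - c))"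
begin

definition state :: "(int \<Rightarrow> 'a) \<Rightarrow> int \<Rightarrow> int \<Rightarrow> 'a" where
  "state x a = restrict (\<lambda>j. x (a + j)) {-N..N}"

lemma state_eq_iff: "state x a = state x' b \<longleftrightarrow> (\<forall>j. \<bar>j\<bar> \<le> N \<longrightarrow> x (a + j) = x' (b + j))"
  by (force simp: state_def restrict_def fun_eq_iff abs_le_iff)

lemma state_cong: "(\<And>i. \<bar>i - a\<bar> \<le> N \<Longrightarrow> x i = x' i) \<Longrightarrow> state x a = state x' a"
  by (simp add: state_eq_iff)

lemma state_translate: "state (translate c x) a = state x (a + c)"
  by (simp add: state_eq_iff translate_def algebra_simps)

lemma code_cong:
  assumes "x \<in> X" "x' \<in> X" "state x a = state x' a"
  shows "\<pi> x a = \<pi> x' a"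
proof (rule code_local[OF assms(1,2)])
  fix i assume "\<bar>i - a\<bar> \<le> N"
  then show "x i = x' i" using assms(3) unfolding state_eq_iff
    by (metis add_diff_cancel_left' add.commute diff_add_cancel)
qed

definition states :: "(int \<Rightarrow> 'a) set" where
  "states = {-N..N} \<rightarrow>\<^sub>E A"

lemma finite_states: "finite states"
  unfolding states_def by (intro finite_PiE finite_alphabet) simp

lemma state_in_states: "x \<in> X \<Longrightarrow> state x a \<in> states"
  by (auto simp: states_def state_def in_alphabet)

lemma join_at_equal_states:
  assumes x: "x \<in> X" "x' \<in> X" and eq: "state x a = state x' a"
  shows "join x a x' \<in> X"
    and "i \<le> a + N \<Longrightarrow> join x a x' i = x i"
    and "a - N \<le> i \<Longrightarrow> join x a x' i = x' i"
    and "j \<le> a \<Longrightarrow> state (join x a x') j = state x j"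
    and "a \<le> j \<Longrightarrow> state (join x a x') j = state x' j"
    and "j \<le> a \<Longrightarrow> \<pi> (join x a x') j = \<pi> x j"
    and "a \<le> j \<Longrightarrow> \<pi> (join x a x') j = \<pi> x' j"
proof -
  have window: "x i = x' i" if "\<bar>i - a\<bar> \<le> N" for i
    using eq that unfolding state_eq_iff
    by (metis add_diff_cancel_left' add.commute diff_add_cancel)
  show J: "join x a x' \<in> X" using x window by (rule join_in)
  have l: "join x a x' i = x i" if "i \<le> a + N" for i
    using that window[of i] by (auto simp: join_def)
  have r: "join x a x' i = x' i" if "a - N \<le> i" for i
    using that window[of i] by (auto simp: join_def)
  show "i \<le> a + N \<Longrightarrow> join x a x' i = x i" by (rule l)
  show "a - N \<le> i \<Longrightarrow> join x a x' i = x' i" by (rule r)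
  show sl: "state (join x a x') j = state x j" if "j \<le> a" for j
    by (rule state_cong, rule l) (use that in linarith)
  show sr: "state (join x a x') j = state x' j" if "a \<le> j" for j
    by (rule state_cong, rule r) (use that in linarith)
  show "\<pi> (join x a x') j = \<pi> x j" if "j \<le> a"
    using code_cong[OF J x(1) sl[OF that]] .
  show "\<pi> (join x a x') j = \<pi> x' j" if "a \<le> j"
    using code_cong[OF J x(2) sr[OF that]] .
qed

lemma cluster_point_code:
  assumes "\<And>k. f k \<in> X"
  obtains z where "z \<in> X"
    "\<And>n. \<exists>k\<ge>n. \<forall>i. \<bar>i\<bar> \<le> int n \<longrightarrow>
      f k i = z i \<and> \<pi> (f k) i = \<pi> z i \<and> state (f k) i = state z i"
proof -
  obtain z where z: "z \<in> X" "\<And>n. \<exists>k\<ge>n. \<forall>i. \<bar>i\<bar> \<le> int n \<longrightarrow> f k i = z i"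
    using cluster_point[of f] assms by blast
  have "\<exists>k\<ge>n. \<forall>i. \<bar>i\<bar> \<le> int n \<longrightarrow>
      f k i = z i \<and> \<pi> (f k) i = \<pi> z i \<and> state (f k) i = state z i" for n
  proof -
    obtain k where k: "k \<ge> n + nat N" "\<And>i. \<bar>i\<bar> \<le> int (n + nat N) \<Longrightarrow> f k i = z i"
      using z(2)[of "n + nat N"] by blast
    have near: "f k i = z i" if "\<bar>j\<bar> \<le> int n" "\<bar>i - j\<bar> \<le> N" for i j
      using k(2)[of i] that N_nonneg by simp
    show ?thesis
    proof (intro exI[of _ k] conjI allI impI)
      fix i assume i: "\<bar>i\<bar> \<le> int n"
      show "f k i = z i" using near[OF i, of i] N_nonneg by simp
      show "state (f k) i = state z i" using near[OF i] by (rule state_cong)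
      then show "\<pi> (f k) i = \<pi> z i" by (rule code_cong[OF assms z(1)])
    qed (use k in simp)
  qed
  with z(1) show ?thesis by (rule that)
qed

section \<open>Reachability over a point of the image\<close>

definition over :: "(int \<Rightarrow> 'b) \<Rightarrow> int \<Rightarrow> int \<Rightarrow> (int \<Rightarrow> 'a) \<Rightarrow> bool" where
  "over y a b z \<longleftrightarrow> z \<in> X \<and> (\<forall>i. a \<le> i \<and> i \<le> b \<longrightarrow> \<pi> z i = y i)"

definition reach :: "(int \<Rightarrow> 'b) \<Rightarrow> int \<Rightarrow> int \<Rightarrow> (int \<Rightarrow> 'a) \<Rightarrow> (int \<Rightarrow> 'a) \<Rightarrow> bool" where
  "reach y a b s t \<longleftrightarrow> a \<le> b \<and> (\<exists>z. over y a b z \<and> state z a = s \<and> state z b = t)"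

lemma reach_le: "reach y a b s t \<Longrightarrow> a \<le> b"
  by (simp add: reach_def)

lemma reach_point: "a \<le> b \<Longrightarrow> over y a b z \<Longrightarrow> reach y a b (state z a) (state z b)"
  unfolding reach_def by blast

lemma over_fibre: "z \<in> X \<Longrightarrow> \<pi> z = y \<Longrightarrow> over y a b z"
  by (simp add: over_def)

lemma over_mono: "over y a b z \<Longrightarrow> a \<le> a' \<Longrightarrow> b' \<le> b \<Longrightarrow> over y a' b' z"
  by (auto simp: over_def)

lemma over_cong: "(\<And>i. a \<le> i \<Longrightarrow> i \<le> b \<Longrightarrow> y i = y' i) \<Longrightarrow> over y a b = over y' a b"
  by (auto simp: over_def fun_eq_iff)

lemma reach_cong: "(\<And>i. a \<le> i \<Longrightarrow> i \<le> b \<Longrightarrow> y i = y' i) \<Longrightarrow> reach y a b = reach y' a b"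
  using over_cong[of a b y y'] by (auto simp: reach_def fun_eq_iff)

lemma reach_trans:
  assumes "reach y a b s t" "reach y b c t u"
  shows "reach y a c s u"
proof -
  obtain z where z: "over y a b z" "state z a = s" "state z b = t"
    using assms(1) unfolding reach_def by blast
  obtain z' where z': "over y b c z'" "state z' b = t" "state z' c = u"
    using assms(2) unfolding reach_def by blast
  have ab: "a \<le> b" "b \<le> c" using assms by (auto dest: reach_le)
  have X: "z \<in> X" "z' \<in> X" and eq: "state z b = state z' b"
    using z z' by (auto simp: over_def)
  note J = join_at_equal_states[OF X eq]
  have "over y a c (join z b z')"
    unfolding over_def
  proof (intro conjI allI impI)
    fix i assume "a \<le> i \<and> i \<le> c"
    then show "\<pi> (join z b z') i = y i"
      using J(6,7)[of i] z(1) z'(1) unfolding over_def by (cases "i \<le> b") auto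
  qed (rule J(1))
  then show ?thesis
    using J(4)[of a] J(5)[of c] ab z z' unfolding reach_def by auto
qed

lemma reach_split:
  assumes "reach y a c s u" "a \<le> b" "b \<le> c"
  obtains t where "reach y a b s t" "reach y b c t u"
proof -
  obtain z where z: "over y a c z" "state z a = s" "state z c = u"
    using assms(1) unfolding reach_def by blast
  have "over y a b z" "over y b c z" using z(1) assms by (auto intro: over_mono)
  from reach_point[OF assms(2) this(1)] reach_point[OF assms(3) this(2)] show ?thesis
    using that z by simp
qed

lemma over_translate: "over (translate c y) a b z \<longleftrightarrow> over y (a + c) (b + c) (translate (- c) z)"
proof (cases "z \<in> X")
  case True
  have "(\<forall>i. a \<le> i \<and> i \<le> b \<longrightarrow> \<pi> z i = y (i + c)) \<longleftrightarrow>
     (\<forall>i. a + c \<le> i \<and> i \<le> b + c \<longrightarrow> \<pi> z (i - c) = y i)"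
    (is "?l \<longleftrightarrow> ?r")
  proof
    assume l: ?l
    show ?r
    proof (intro allI impI)
      fix i assume "a + c \<le> i \<and> i \<le> b + c"
      then show "\<pi> z (i - c) = y i" using l[rule_format, of "i - c"] by simp
    qed
  next
    assume r: ?r
    show ?l
    proof (intro allI impI)
      fix i assume "a \<le> i \<and> i \<le> b"
      then show "\<pi> z i = y (i + c)" using r[rule_format, of "i + c"] by simp
    qed
  qed
  then show ?thesis using True
    by (simp add: over_def translate_in code_translate) (simp add: translate_def)
next
  case False
  have "translate c (translate (- c) z) = z" by (simp add: translate_def)
  with False show ?thesis by (metis over_def translate_in)
qed

lemma reach_translate: "reach (translate c y) a b s t \<longleftrightarrow> reach y (a + c) (b + c) s t"
proof -
  have "(\<exists>z. over (translate c y) a b z \<and> state z a = s \<and> state z b = t) \<longleftrightarrow>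
    (\<exists>z. over y (a + c) (b + c) z \<and> state z (a + c) = s \<and> state z (b + c) = t)" (is "?l \<longleftrightarrow> ?r")
  proof
    assume ?l
    then obtain z where "over (translate c y) a b z" "state z a = s" "state z b = t" by blast
    then show ?r
      by (intro exI[of _ "translate (- c) z"]) (simp add: over_translate state_translate)
  next
    assume ?r
    then obtain z where "over y (a + c) (b + c) z" "state z (a + c) = s" "state z (b + c) = t"
      by blast
    moreover have "translate (- c) (translate c z) = z" by (simp add: translate_def)
    ultimately show ?l
      by (intro exI[of _ "translate c z"]) (simp add: over_translate state_translate)
  qed
  then show ?thesis by (simp add: reach_def)
qed

lemma reach_shifted:
  assumes "\<And>i. a \<le> i \<Longrightarrow> i \<le> b \<Longrightarrow> y' (i + c) = y i"
  shows "reach y' (a + c) (b + c) = reach y a b"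
proof -
  have "reach (translate c y') a b = reach y a b"
    by (rule reach_cong) (simp add: assms translate_def)
  then show ?thesis by (auto simp: reach_translate fun_eq_iff)
qed

lemma reach_between_points:
  assumes X: "x \<in> X" "x' \<in> X" and r: "reach y a b (state x a) (state x' b)"
  obtains z where "z \<in> X" "\<And>i. i \<le> a \<Longrightarrow> z i = x i" "\<And>i. b \<le> i \<Longrightarrow> z i = x' i"
    "\<And>i. i \<le> a \<Longrightarrow> \<pi> z i = \<pi> x i" "\<And>i. b \<le> i \<Longrightarrow> \<pi> z i = \<pi> x' i"
    "\<And>i. a \<le> i \<Longrightarrow> i \<le> b \<Longrightarrow> \<pi> z i = y i"
proof -
  obtain w where w: "over y a b w" "state w a = state x a" "state w b = state x' b"
    and ab: "a \<le> b"
    using r unfolding reach_def by blast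
  have W: "w \<in> X" using w(1) by (simp add: over_def)
  note J = join_at_equal_states[OF W X(2) w(3)]
  have eq: "state x a = state (join w b x') a" using J(4)[of a] w(2) ab by simp
  note K = join_at_equal_states[OF X(1) J(1) eq]
  show ?thesis
  proof (rule that[OF K(1)])
    show "join x a (join w b x') i = x i" if "i \<le> a" for i
      using that by (simp add: join_def)
    show "join x a (join w b x') i = x' i" if "b \<le> i" for i
      using K(3)[of i] J(3)[of i] ab that N_nonneg by simp
    show "\<pi> (join x a (join w b x')) i = \<pi> x i" if "i \<le> a" for i
      using that by (rule K(6))
    show "\<pi> (join x a (join w b x')) i = \<pi> x' i" if "b \<le> i" for i
      using K(7)[of i] J(7)[of i] ab that by simp
    show "\<pi> (join x a (join w b x')) i = y i" if "a \<le> i" "i \<le> b" for i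
      using K(7)[of i] J(6)[of i] ab that w(1) by (simp add: over_def)
  qed
qed

text \<open>Rephrases bridges by reachability, with a start at every time. The windows cost \<open>N\<close> symbols on
  either side, which does not matter because bridges are required for all \<open>m\<close>.\<close>

lemma right_to_iff:
  assumes X: "x \<in> X" "x' \<in> X" and y: "\<pi> x = y" "\<pi> x' = y"
  shows "right_to X \<pi> x x' \<longleftrightarrow> (\<forall>a. \<exists>b. reach y a b (state x a) (state x' b))"
proof (intro iffI allI)
  fix a assume "right_to X \<pi> x x'"
  then obtain z n where z: "z \<in> X" "\<pi> z = y" "n > a + N"
    "\<And>i. i \<le> a + N \<Longrightarrow> z i = x i" "\<And>i. i \<ge> n \<Longrightarrow> z i = x' i"
    unfolding right_to_def right_bridge_def y by blast
  have "state z a = state x a" by (rule state_cong, rule z(4)) linarith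
  moreover have "state z (n + N) = state x' (n + N)" by (rule state_cong, rule z(5)) linarith
  moreover have "a \<le> n + N" using z(3) N_nonneg by linarith
  ultimately show "\<exists>b. reach y a b (state x a) (state x' b)"
    using reach_point[of a "n + N" y z] over_fibre[OF z(1,2)] by metis
next
  assume r: "\<forall>a. \<exists>b. reach y a b (state x a) (state x' b)"
  show "right_to X \<pi> x x'"
    unfolding right_to_def
  proof
    fix m
    obtain b where b: "reach y m b (state x m) (state x' b)" using r by blast
    then have mb: "m \<le> b" by (rule reach_le)
    obtain z where z: "z \<in> X" "\<And>i. i \<le> m \<Longrightarrow> z i = x i" "\<And>i. b \<le> i \<Longrightarrow> z i = x' i"
      "\<And>i. i \<le> m \<Longrightarrow> \<pi> z i = \<pi> x i" "\<And>i. b \<le> i \<Longrightarrow> \<pi> z i = \<pi> x' i"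
      "\<And>i. m \<le> i \<Longrightarrow> i \<le> b \<Longrightarrow> \<pi> z i = y i"
      using reach_between_points[OF X b] by metis
    have "\<pi> z i = y i" for i
      using z(4,5,6)[of i] y by (cases "i \<le> m"; cases "b \<le> i") auto
    then have "right_bridge X \<pi> m x x' z"
      unfolding right_bridge_def using z(1-3) mb y
      by (intro conjI exI[of _ "b + 1"]) auto
    then show "\<exists>z. right_bridge X \<pi> m x x' z" by blast
  qed
qed

text \<open>Bridges need only be found far to the right, because one may first follow \<open>x\<close> itself.\<close>

lemma right_toI_eventually:
  assumes X: "x \<in> X" "x' \<in> X" and y: "\<pi> x = y" "\<pi> x' = y"
    and r: "\<And>a. a \<ge> m \<Longrightarrow> \<exists>b. reach y a b (state x a) (state x' b)"
  shows "right_to X \<pi> x x'"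
  unfolding right_to_iff[OF X y]
proof
  fix a
  obtain b where "reach y (max a m) b (state x (max a m)) (state x' b)" using r by fastforce
  moreover have "reach y a (max a m) (state x a) (state x (max a m))"
    by (rule reach_point[OF _ over_fibre[OF X(1) y(1)]]) simp
  ultimately show "\<exists>b. reach y a b (state x a) (state x' b)" using reach_trans by blast
qed

lemma right_to_refl: "x \<in> X \<Longrightarrow> right_to X \<pi> x x"
  by (rule right_toI_eventually[of _ _ "\<pi> x" 0])
    (auto intro!: exI reach_point over_fibre)

lemma right_to_trans:
  assumes X: "x \<in> X" "x' \<in> X" "x'' \<in> X" and y: "\<pi> x = y" "\<pi> x' = y" "\<pi> x'' = y"
    and "right_to X \<pi> x x'" "right_to X \<pi> x' x''"
  shows "right_to X \<pi> x x''"
  using assms(7,8) right_to_iff[OF X(1,2) y(1,2)] right_to_iff[OF X(2,3) y(2,3)]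
    right_to_iff[OF X(1,3) y(1,3)] reach_trans by metis

lemma right_equivalent_fibre_equiv:
  "equiv (fibre X \<pi> y) {(x, x'). x \<in> fibre X \<pi> y \<and> x' \<in> fibre X \<pi> y \<and> right_equivalent X \<pi> x x'}"
  by (rule equivI)
    (auto simp: refl_on_def sym_def trans_def right_equivalent_def fibre_def
      intro: right_to_refl right_to_trans[of _ _ _ y])


section \<open>Transition blocks and minimal depth\<close>

definition tblock :: "(int \<Rightarrow> 'b) \<Rightarrow> int \<Rightarrow> int \<Rightarrow> int \<Rightarrow> (int \<Rightarrow> 'a) set \<Rightarrow> bool" where
  "tblock y a n b M \<longleftrightarrow> a \<le> n \<and> n \<le> b \<and>
    (\<forall>s t. reach y a b s t \<longrightarrow> (\<exists>r\<in>M. reach y a n s r \<and> reach y n b r t))"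

text \<open>The class degree in terms of blocks, see \<open>class_degree_eq_min_depth\<close>. Unlike the number of right
  classes, this quantity is visibly invariant under reversal of time.\<close>

definition min_depth :: nat where
  "min_depth = (LEAST k. \<exists>y\<in>\<pi> ` X. \<exists>a n b M. tblock y a n b M \<and> finite M \<and> card M = k)"

definition mblock :: "(int \<Rightarrow> 'b) \<Rightarrow> int \<Rightarrow> int \<Rightarrow> int \<Rightarrow> (int \<Rightarrow> 'a) set \<Rightarrow> bool" where
  "mblock y a n b M \<longleftrightarrow> tblock y a n b M \<and> finite M \<and> card M = min_depth"

lemma tblock_order: "tblock y a n b M \<Longrightarrow> a \<le> n \<and> n \<le> b"
  by (simp add: tblock_def)

lemma tblock_through:
  "tblock y a n b M \<Longrightarrow> reach y a b s t \<Longrightarrow> \<exists>r\<in>M. reach y a n s r \<and> reach y n b r t"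
  by (simp add: tblock_def)

lemma tblock_states:
  assumes "a \<le> n" "n \<le> b"
  shows "tblock y a n b states"
  unfolding tblock_def
proof (intro conjI allI impI assms)
  fix s t assume "reach y a b s t"
  then obtain z where z: "over y a b z" "state z a = s" "state z b = t"
    unfolding reach_def by blast
  have "over y a n z" "over y n b z" using z(1) assms by (auto intro: over_mono)
  from reach_point[OF assms(1) this(1)] reach_point[OF assms(2) this(2)] z
  show "\<exists>r\<in>states. reach y a n s r \<and> reach y n b r t"
    using state_in_states by (auto simp: over_def)
qed

lemma tblock_cong:
  assumes "\<And>i. a \<le> i \<Longrightarrow> i \<le> b \<Longrightarrow> y' (i + c) = y i"
  shows "tblock y' (a + c) (n + c) (b + c) M \<longleftrightarrow> tblock y a n b M"
proof (cases "a \<le> n \<and> n \<le> b")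
  case True
  then have "reach y' (a + c) (b + c) = reach y a b" "reach y' (a + c) (n + c) = reach y a n"
    "reach y' (n + c) (b + c) = reach y n b"
    using assms by (auto intro!: reach_shifted)
  then show ?thesis by (simp add: tblock_def)
qed (auto simp: tblock_def)

lemma mblock_cong:
  "(\<And>i. a \<le> i \<Longrightarrow> i \<le> b \<Longrightarrow> y' (i + c) = y i) \<Longrightarrow>
    mblock y' (a + c) (n + c) (b + c) M \<longleftrightarrow> mblock y a n b M"
  by (simp add: mblock_def tblock_cong)

lemma min_depth_le:
  "y \<in> \<pi> ` X \<Longrightarrow> tblock y a n b M \<Longrightarrow> finite M \<Longrightarrow> min_depth \<le> card M"
  unfolding min_depth_def by (rule Least_le) blast

lemma mblock_exists: "\<exists>y\<in>\<pi> ` X. \<exists>a n b M. mblock y a n b M"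
proof -
  obtain y where "y \<in> \<pi> ` X" using nonempty by blast
  moreover have "tblock y 0 0 0 states" by (rule tblock_states) simp_all
  ultimately have "\<exists>k. \<exists>y\<in>\<pi> ` X. \<exists>a n b M. tblock y a n b M \<and> finite M \<and> card M = k"
    using finite_states by blast
  then have "\<exists>y\<in>\<pi> ` X. \<exists>a n b M. tblock y a n b M \<and> finite M \<and> card M = min_depth"
    unfolding min_depth_def by (rule LeastI_ex)
  then show ?thesis by (simp add: mblock_def)
qed

text \<open>Removing \<open>r\<close> from \<open>M\<close> leaves too few states for a transition block, so some passage from \<open>p\<close> to
  \<open>q\<close> over the whole interval cannot avoid \<open>r\<close>. Rerouting it through the two outer blocks gives \<open>s\<close>
  and \<open>t\<close>.\<close>

lemma mblock_bottleneck:
  assumes y: "y \<in> \<pi> ` X"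
    and B1: "tblock y a1 n1 b1 M1" and B: "mblock y a n b M" and B3: "tblock y a3 n3 b3 M3"
    and ord: "b1 \<le> a" "b \<le> a3" and r: "r \<in> M"
  shows "\<exists>p. \<exists>s\<in>M1. \<exists>t\<in>M3. \<exists>q. reach y a1 n1 p s \<and> reach y n1 n s r \<and>
    reach y n n3 r t \<and> reach y n3 b3 t q \<and>
    (\<forall>r'\<in>M. reach y n1 n s r' \<and> reach y n n3 r' t \<longrightarrow> r' = r)"
proof -
  have o: "a1 \<le> n1" "n1 \<le> b1" "a \<le> n" "n \<le> b" "a3 \<le> n3" "n3 \<le> b3"
    using B1 B B3 by (auto simp: mblock_def dest: tblock_order)
  have M: "finite M" "card M = min_depth" and T: "tblock y a n b M"
    using B by (auto simp: mblock_def)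
  have "card (M - {r}) < min_depth" using card_Diff1_less[OF M(1) r] M(2) by simp
  then have "\<not> tblock y a1 n b3 (M - {r})"
    using min_depth_le[OF y, of a1 n b3 "M - {r}"] M(1) by auto
  moreover have "a1 \<le> n" "n \<le> b3" using o ord by auto
  ultimately obtain p q where pq: "reach y a1 b3 p q"
    and no: "\<And>r'. r' \<in> M - {r} \<Longrightarrow> reach y a1 n p r' \<Longrightarrow> reach y n b3 r' q \<Longrightarrow> False"
    unfolding tblock_def by blast
  obtain u1 where u1: "reach y a1 b1 p u1" "reach y b1 b3 u1 q"
    using reach_split[OF pq, of b1] o ord by auto
  obtain u2 where u2: "reach y b1 a u1 u2" "reach y a b3 u2 q"
    using reach_split[OF u1(2), of a] o ord by auto
  obtain u3 where u3: "reach y a b u2 u3" "reach y b b3 u3 q"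
    using reach_split[OF u2(2), of b] o ord by auto
  obtain u4 where u4: "reach y b a3 u3 u4" "reach y a3 b3 u4 q"
    using reach_split[OF u3(2), of a3] o ord by auto
  obtain s where s: "s \<in> M1" "reach y a1 n1 p s" "reach y n1 b1 s u1"
    using tblock_through[OF B1 u1(1)] by blast
  obtain r0 where r0: "r0 \<in> M" "reach y a n u2 r0" "reach y n b r0 u3"
    using tblock_through[OF T u3(1)] by blast
  obtain t where t: "t \<in> M3" "reach y a3 n3 u4 t" "reach y n3 b3 t q"
    using tblock_through[OF B3 u4(2)] by blast
  have sr0: "reach y n1 n s r0" using s(3) u2(1) r0(2) reach_trans by blast
  have r0t: "reach y n n3 r0 t" using r0(3) u4(1) t(2) reach_trans by blast
  have only: "r' = r" if "r' \<in> M" "reach y n1 n s r'" "reach y n n3 r' t" for r'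
    using no[of r'] that s(2) t(3) reach_trans by blast
  have "r0 = r" using only r0(1) sr0 r0t by blast
  then show ?thesis using s(1,2) t(1,3) sr0 r0t only by blast
qed

lemma connect_points:
  assumes "x \<in> X" "x' \<in> X"
  obtains z c where "z \<in> X" "a < b + c"
    "\<And>i. i \<le> a \<Longrightarrow> z i = x i" "\<And>i. b \<le> i \<Longrightarrow> z (i + c) = x' i"
    "\<And>i. i \<le> a \<Longrightarrow> state z i = state x i" "\<And>i. b \<le> i \<Longrightarrow> state z (i + c) = state x' i"
    "\<And>i. i \<le> a \<Longrightarrow> \<pi> z i = \<pi> x i" "\<And>i. b \<le> i \<Longrightarrow> \<pi> z (i + c) = \<pi> x' i"
proof -
  obtain z c where z: "z \<in> X" "a + N < b - N + c" "\<And>i. i \<le> a + N \<Longrightarrow> z i = x i"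
    "\<And>i. i \<ge> b - N + c \<Longrightarrow> z i = x' (i - c)"
    using connect[OF assms, of "a + N" "b - N"] by blast
  have sl: "state z i = state x i" if "i \<le> a" for i
    by (rule state_cong, rule z(3)) (use that in linarith)
  have sr': "state (translate c z) i = state x' i" if "b \<le> i" for i
    by (rule state_cong) (use that z(4) in \<open>simp add: translate_def\<close>)
  show ?thesis
  proof (rule that[of z c])
    show "z \<in> X" by (rule z(1))
    show "a < b + c" using z(2) N_nonneg by linarith
    show "z i = x i" if "i \<le> a" for i using z(3)[of i] that N_nonneg by linarith
    show "z (i + c) = x' i" if "b \<le> i" for i using z(4)[of "i + c"] that N_nonneg by simp
    show "state z i = state x i" if "i \<le> a" for i using sl that .
    show "state z (i + c) = state x' i" if "b \<le> i" for i
      using sr'[OF that] by (simp add: state_translate)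
    show "\<pi> z i = \<pi> x i" if "i \<le> a" for i using code_cong[OF z(1) assms(1) sl[OF that]] .
    show "\<pi> z (i + c) = \<pi> x' i" if "b \<le> i" for i
      using code_cong[OF translate_in[OF z(1)] assms(2) sr'[OF that]]
      unfolding code_translate[OF z(1)] by (simp add: translate_def)
  qed
qed

section \<open>Return relations of a minimal block\<close>

text \<open>One relation for each point that shows the block \<open>y0\<close> on \<open>[a, b]\<close> at time \<open>0\<close> and again, disjointly
  up to an end point, after a time \<open>c\<close>.\<close>

definition returns ::
  "(int \<Rightarrow> 'b) \<Rightarrow> int \<Rightarrow> int \<Rightarrow> int \<Rightarrow> (int \<Rightarrow> 'a) set \<Rightarrow> ((int \<Rightarrow> 'a) \<times> (int \<Rightarrow> 'a)) set set"
  where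
  "returns y0 a n b M = {{(s, t). s \<in> M \<and> t \<in> M \<and> reach y n (n + c) s t} |y c.
    y \<in> \<pi> ` X \<and> b \<le> a + c \<and> (\<forall>i. a \<le> i \<and> i \<le> b \<longrightarrow> y i = y0 i \<and> y (i + c) = y0 i)}"

lemma mblock_state_realized:
  assumes y: "y \<in> \<pi> ` X" and B: "mblock y a n b M" and r: "r \<in> M"
  obtains x where "over y a b x" "state x n = r"
proof -
  have o: "a \<le> n" "n \<le> b" using B by (auto simp: mblock_def dest: tblock_order)
  obtain s t where "reach y a n s r" "reach y n b r t"
    using mblock_bottleneck[OF y tblock_states[of a a a] B tblock_states[of b b b] _ _ r] by auto
  then obtain x x' where x: "over y a n x" "state x n = r" "over y n b x'" "state x' n = r"
    unfolding reach_def by blast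
  have X: "x \<in> X" "x' \<in> X" "state x n = state x' n" using x by (auto simp: over_def)
  note J = join_at_equal_states[OF X]
  have "over y a b (join x n x')" unfolding over_def
  proof (intro conjI allI impI)
    fix i assume "a \<le> i \<and> i \<le> b"
    then show "\<pi> (join x n x') i = y i"
      using J(6,7)[of i] x unfolding over_def by (cases "i \<le> n") auto
  qed (rule J(1))
  then show ?thesis using that J(4)[of n] x(2) by auto
qed

lemma mblock_nonempty:
  assumes y: "y \<in> \<pi> ` X" and B: "mblock y a n b M"
  shows "M \<noteq> {}"
proof -
  obtain x where "x \<in> X" "\<pi> x = y" using y by blast
  then have "reach y a b (state x a) (state x b)"
    using B by (intro reach_point over_fibre) (auto simp: mblock_def dest: tblock_order)
  then show ?thesis using tblock_through B unfolding mblock_def by blast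
qed

text \<open>The image need not have finite memory, so two words that both contain the block cannot simply be
  overlapped in it. They can here: some passage over the first word ends in a state \<open>r\<close> of \<open>M\<close>, some
  passage over the second starts in the same \<open>r\<close>, and splicing them in \<open>X\<close> gives the required point.\<close>

lemma returns_concatenate:
  assumes y0: "y0 \<in> \<pi> ` X" and B: "mblock y0 a n b M"
    and G: "G \<in> returns y0 a n b M" and H: "H \<in> returns y0 a n b M"
  obtains y c d where "y \<in> \<pi> ` X" "b \<le> a + c" "b \<le> a + d"
    "\<And>i. a \<le> i \<Longrightarrow> i \<le> b \<Longrightarrow> y i = y0 i"
    "\<And>i. a \<le> i \<Longrightarrow> i \<le> b \<Longrightarrow> y (i + c) = y0 i"
    "\<And>i. a \<le> i \<Longrightarrow> i \<le> b \<Longrightarrow> y (i + (c + d)) = y0 i"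
    "G = {(s, t). s \<in> M \<and> t \<in> M \<and> reach y n (n + c) s t}"
    "H = {(s, t). s \<in> M \<and> t \<in> M \<and> reach y (n + c) (n + (c + d)) s t}"
proof -
  have o: "a \<le> n" "n \<le> b" using B by (auto simp: mblock_def dest: tblock_order)
  obtain y1 c where y1: "y1 \<in> \<pi> ` X" "b \<le> a + c"
    "\<And>i. a \<le> i \<Longrightarrow> i \<le> b \<Longrightarrow> y1 i = y0 i" "\<And>i. a \<le> i \<Longrightarrow> i \<le> b \<Longrightarrow> y1 (i + c) = y0 i"
    and Geq: "G = {(s, t). s \<in> M \<and> t \<in> M \<and> reach y1 n (n + c) s t}"
    using G unfolding returns_def by blast
  obtain y2 d where y2: "y2 \<in> \<pi> ` X" "b \<le> a + d"
    "\<And>i. a \<le> i \<Longrightarrow> i \<le> b \<Longrightarrow> y2 i = y0 i" "\<And>i. a \<le> i \<Longrightarrow> i \<le> b \<Longrightarrow> y2 (i + d) = y0 i"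
    and Heq: "H = {(s, t). s \<in> M \<and> t \<in> M \<and> reach y2 n (n + d) s t}"
    using H unfolding returns_def by blast
  have B1: "mblock y1 a n b M" "mblock y1 (a + c) (n + c) (b + c) M"
    using B mblock_cong[of a b y1 0 y0 n M] mblock_cong[of a b y1 c y0 n M] y1 by auto
  have B2: "mblock y2 a n b M" "mblock y2 (a + d) (n + d) (b + d) M"
    using B mblock_cong[of a b y2 0 y0 n M] mblock_cong[of a b y2 d y0 n M] y2 by auto
  obtain r where r: "r \<in> M" using mblock_nonempty[OF y0 B] by blast
  have T1: "tblock y1 a n b M" using B1(1) by (simp add: mblock_def)
  have T2: "tblock y2 (a + d) (n + d) (b + d) M" using B2(2) by (simp add: mblock_def)
  obtain p s where "reach y1 a n p s" "reach y1 n (n + c) s r"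
    using mblock_bottleneck[OF y1(1) T1 B1(2) tblock_states[of "b + c" "b + c" "b + c"] y1(2) _ r]
    by auto
  then have "reach y1 a (n + c) p r" by (rule reach_trans)
  then obtain z1 where z1: "over y1 a (n + c) z1" "state z1 (n + c) = r"
    unfolding reach_def by blast
  obtain t q where "reach y2 n (n + d) r t" "reach y2 (n + d) (b + d) t q"
    using mblock_bottleneck[OF y2(1) tblock_states[of a a a] B2(1) T2 _ y2(2) r] by auto
  then have "reach y2 n (b + d) r q" by (rule reach_trans)
  then obtain z2 where z2: "over y2 n (b + d) z2" "state z2 n = r"
    unfolding reach_def by blast
  define z3 where "z3 = translate (- c) z2"
  have z2X: "z2 \<in> X" using z2 by (simp add: over_def)
  have z3: "z3 \<in> X" "\<And>i. \<pi> z3 i = \<pi> z2 (i - c)"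
    unfolding z3_def code_translate[OF z2X]
    by (rule translate_in[OF z2X]) (simp add: translate_def)
  have eq: "state z1 (n + c) = state z3 (n + c)"
    using z1 z2 by (simp add: z3_def state_translate)
  have z1X: "z1 \<in> X" using z1 by (simp add: over_def)
  note J = join_at_equal_states[OF z1X z3(1) eq]
  define y where "y = \<pi> (join z1 (n + c) z3)"
  have left: "y i = y1 i" if "a \<le> i" "i \<le> n + c" for i
    using that J(6)[of i] z1(1) by (simp add: y_def over_def)
  have right: "y (i + c) = y2 i" if "n \<le> i" "i \<le> b + d" for i
    using that J(7)[of "i + c"] z2(1) z3(2) by (simp add: y_def over_def)
  have "reach y n (n + c) = reach y1 n (n + c)"
    by (rule reach_cong) (use left o in auto)
  moreover have "reach y (n + c) (n + d + c) = reach y2 n (n + d)"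
    by (rule reach_shifted) (use right o in auto)
  ultimately show ?thesis
  proof (intro that[of y c d])
    show "y \<in> \<pi> ` X" unfolding y_def using J(1) by blast
    show "y i = y0 i" if "a \<le> i" "i \<le> b" for i
      using left[of i] y1(3)[of i] that o y1(2) by simp
    show "y (i + c) = y0 i" if "a \<le> i" "i \<le> b" for i
    proof (cases "i \<le> n")
      case True
      then show ?thesis using left[of "i + c"] y1(2) y1(4)[of i] that o by simp
    next
      case False
      then show ?thesis using right[of i] y2(2) y2(3)[of i] that o by simp
    qed
    show "y (i + (c + d)) = y0 i" if "a \<le> i" "i \<le> b" for i
      using right[of "i + d"] y2(2) y2(4)[of i] that o by (simp add: algebra_simps)
  qed (use y1(2) y2(2) Geq Heq in \<open>auto simp: algebra_simps\<close>)
qed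

lemma returns_semigroup:
  assumes y0: "y0 \<in> \<pi> ` X" and B: "mblock y0 a n b M"
  shows "minimal_relation_semigroup M (returns y0 a n b M)"
proof
  have o: "a \<le> n" "n \<le> b" using B by (auto simp: mblock_def dest: tblock_order)
  show "finite M" using B by (simp add: mblock_def)
  show "G \<subseteq> M \<times> M" if "G \<in> returns y0 a n b M" for G
    using that by (auto simp: returns_def)
  fix G H assume GH: "G \<in> returns y0 a n b M" "H \<in> returns y0 a n b M"
  obtain y c d where y: "y \<in> \<pi> ` X" and cd: "b \<le> a + c" "b \<le> a + d"
    and blocks: "\<And>i. a \<le> i \<Longrightarrow> i \<le> b \<Longrightarrow> y i = y0 i"
    "\<And>i. a \<le> i \<Longrightarrow> i \<le> b \<Longrightarrow> y (i + c) = y0 i"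
    "\<And>i. a \<le> i \<Longrightarrow> i \<le> b \<Longrightarrow> y (i + (c + d)) = y0 i"
    and Geq: "G = {(s, t). s \<in> M \<and> t \<in> M \<and> reach y n (n + c) s t}"
    and Heq: "H = {(s, t). s \<in> M \<and> t \<in> M \<and> reach y (n + c) (n + (c + d)) s t}"
    using returns_concatenate[OF y0 B GH] by blast
  have B1: "tblock y a n b M"
    using B mblock_cong[of a b y 0 y0 n M] blocks by (auto simp: mblock_def)
  have B2: "mblock y (a + c) (n + c) (b + c) M"
    using B mblock_cong[of a b y c y0 n M] blocks by auto
  have B3: "tblock y (a + (c + d)) (n + (c + d)) (b + (c + d)) M"
    using B mblock_cong[of a b y "c + d" y0 n M] blocks by (auto simp: mblock_def)
  show "\<exists>s t. (s, r) \<in> G \<and> (r, t) \<in> H \<and> (\<forall>r'. (s, r') \<in> G \<and> (r', t) \<in> H \<longrightarrow> r' = r)"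
    if r: "r \<in> M" for r
  proof -
    have "b + c \<le> a + (c + d)" using cd by simp
    from mblock_bottleneck[OF y B1 B2 B3 cd(1) this r] obtain s t where
      "s \<in> M" "t \<in> M" "reach y n (n + c) s r" "reach y (n + c) (n + (c + d)) r t"
      "\<forall>r'\<in>M. reach y n (n + c) s r' \<and> reach y (n + c) (n + (c + d)) r' t \<longrightarrow> r' = r"
      by blast
    then show ?thesis using r unfolding Geq Heq by blast
  qed
  have "G O H = {(s, t). s \<in> M \<and> t \<in> M \<and> reach y n (n + (c + d)) s t}"
  proof (intro equalityI subsetI)
    fix e assume "e \<in> {(s, t). s \<in> M \<and> t \<in> M \<and> reach y n (n + (c + d)) s t}"
    then obtain s t where e: "e = (s, t)" "s \<in> M" "t \<in> M" "reach y n (n + (c + d)) s t" by blast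
    obtain u where u: "reach y n (a + c) s u" "reach y (a + c) (n + (c + d)) u t"
      using reach_split[OF e(4), of "a + c"] o cd by auto
    obtain v where v: "reach y (a + c) (b + c) u v" "reach y (b + c) (n + (c + d)) v t"
      using reach_split[OF u(2), of "b + c"] o cd by auto
    obtain r where "r \<in> M" "reach y (a + c) (n + c) u r" "reach y (n + c) (b + c) r v"
      using tblock_through[OF _ v(1)] B2 unfolding mblock_def by blast
    then show "e \<in> G O H" using e u(1) v(2) unfolding Geq Heq by (blast intro: reach_trans)
  qed (auto simp: Geq Heq intro: reach_trans)
  moreover have "b \<le> a + (c + d)" using cd o by linarith
  ultimately show "G O H \<in> returns y0 a n b M"
    unfolding returns_def using y blocks(1,3) by blast
next
  fix s t assume st: "s \<in> M" "t \<in> M"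
  have o: "a \<le> n" "n \<le> b" using B by (auto simp: mblock_def dest: tblock_order)
  obtain x where x: "over y0 a b x" "state x n = s" using mblock_state_realized[OF y0 B st(1)] .
  obtain x' where x': "over y0 a b x'" "state x' n = t" using mblock_state_realized[OF y0 B st(2)] .
  have X: "x \<in> X" "x' \<in> X" using x x' by (auto simp: over_def)
  obtain z c where z: "z \<in> X" "b < a + c"
    "\<And>i. i \<le> b \<Longrightarrow> state z i = state x i" "\<And>i. a \<le> i \<Longrightarrow> state z (i + c) = state x' i"
    "\<And>i. i \<le> b \<Longrightarrow> \<pi> z i = \<pi> x i" "\<And>i. a \<le> i \<Longrightarrow> \<pi> z (i + c) = \<pi> x' i"
    using connect_points[OF X, of b a] by metis
  have "reach (\<pi> z) n (n + c) (state z n) (state z (n + c))"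
    using z o by (intro reach_point over_fibre) auto
  then have "reach (\<pi> z) n (n + c) s t" using z(3,4)[of n] o x x' by simp
  then show "\<exists>G\<in>returns y0 a n b M. (s, t) \<in> G"
    using st z x(1) x'(1)
    by (intro bexI[of _ "{(s, t). s \<in> M \<and> t \<in> M \<and> reach (\<pi> z) n (n + c) s t}"])
      (auto simp: returns_def over_def intro!: exI[of _ "\<pi> z"] exI[of _ c])
qed

text \<open>Irreducibility lets the segment containing both blocks recur. Going from the first block to its
  second occurrence, and from the second block to its second occurrence, are permutations; both
  factor through the relation between the two blocks, which is therefore a bijection. As \<open>M\<close> and \<open>M'\<close>
  have equally many elements, surjectivity and single-valuedness already say so.\<close>

lemma mblock_reach_bijective:
  assumes y: "y \<in> \<pi> ` X" and B: "mblock y a n b M" and B': "mblock y a' n' b' M'"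
    and ord: "b \<le> a'"
  shows "t \<in> M' \<Longrightarrow> \<exists>s\<in>M. reach y n n' s t"
    and "s \<in> M \<Longrightarrow> t \<in> M' \<Longrightarrow> t' \<in> M' \<Longrightarrow> reach y n n' s t \<Longrightarrow> reach y n n' s t' \<Longrightarrow> t = t'"
proof -
  have T: "tblock y a n b M" using B by (simp add: mblock_def)
  show "\<exists>s\<in>M. reach y n n' s t" if "t \<in> M'"
    using mblock_bottleneck[OF y T B' tblock_states[of b' b' b'] ord _ that] by auto
next
  assume st: "s \<in> M" "t \<in> M'" "t' \<in> M'" "reach y n n' s t" "reach y n n' s t'"
  have o: "a \<le> n" "n \<le> b" "a' \<le> n'" "n' \<le> b'"
    using B B' by (auto simp: mblock_def dest: tblock_order)
  obtain x where x: "x \<in> X" "\<pi> x = y" using y by blast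
  obtain z c where z: "z \<in> X" "b' < a + c" "\<And>i. i \<le> b' \<Longrightarrow> \<pi> z i = y i"
    "\<And>i. a \<le> i \<Longrightarrow> \<pi> z (i + c) = y i"
    using connect_points[OF x(1) x(1), of b' a] x(2) by metis
  have yz: "\<pi> z \<in> \<pi> ` X" using z(1) by blast
  have Bz: "mblock (\<pi> z) (a + c) (n + c) (b + c) M" "mblock (\<pi> z) a' n' b' M'"
    "mblock (\<pi> z) (a' + c) (n' + c) (b' + c) M'"
    using mblock_cong[of a b "\<pi> z" c y n M] mblock_cong[of a' b' "\<pi> z" 0 y n' M']
      mblock_cong[of a' b' "\<pi> z" c y n' M'] z B B' ord o by auto
  have R: "reach (\<pi> z) n n' = reach y n n'" by (rule reach_cong) (use z o in auto)
  have closes: "\<exists>u\<in>M. reach (\<pi> z) n' (n + c) t u" if "t \<in> M'" for t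
  proof -
    have "tblock (\<pi> z) (a + c) (n + c) (b + c) M" using Bz(1) by (simp add: mblock_def)
    from mblock_bottleneck[OF yz tblock_states[of a' a' a'] Bz(2) this _ _ that] z(2)
    show ?thesis by auto
  qed
  obtain u where u: "u \<in> M" "reach (\<pi> z) n' (n + c) t u" using closes st by blast
  obtain u' where u': "u' \<in> M" "reach (\<pi> z) n' (n + c) t' u'" using closes st by blast
  define G where "G = {(s, t). s \<in> M \<and> t \<in> M \<and> reach (\<pi> z) n (n + c) s t}"
  define H where "H = {(s, t). s \<in> M' \<and> t \<in> M' \<and> reach (\<pi> z) n' (n' + c) s t}"
  have G: "G \<in> returns y a n b M"
    unfolding returns_def G_def
  proof (intro CollectI exI[of _ "\<pi> z"] exI[of _ c] conjI allI impI refl)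
    show "b \<le> a + c" using z(2) ord o by linarith
  qed (use yz z ord o in auto)
  have H: "H \<in> returns y a' n' b' M'"
    unfolding returns_def H_def
  proof (intro CollectI exI[of _ "\<pi> z"] exI[of _ c] conjI allI impI refl)
    show "b' \<le> a' + c" using z(2) ord o by linarith
  qed (use yz z ord o in auto)
  have "(s, u) \<in> G" "(s, u') \<in> G"
    unfolding G_def using st u u' by (auto simp flip: R intro: reach_trans)
  then have "u = u'"
    using minimal_relation_semigroup.relation_bijective(1)[OF returns_semigroup[OF y B] G] by blast
  obtain e where e: "e \<in> M'" "reach (\<pi> z) (n + c) (n' + c) u e"
  proof -
    have T: "tblock (\<pi> z) (a' + c) (n' + c) (b' + c) M'" using Bz(3) by (simp add: mblock_def)
    from mblock_bottleneck[OF yz tblock_states[of "a + c" "a + c" "a + c"] Bz(1) T _ _ u(1)] ord that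
    show ?thesis by auto
  qed
  have "(t, e) \<in> H" "(t', e) \<in> H"
    unfolding H_def using st u u' e \<open>u = u'\<close> by (auto intro: reach_trans)
  then show "t = t'"
    using minimal_relation_semigroup.relation_bijective(2)[OF returns_semigroup[OF y B'] H] by blast
qed


section \<open>Counting right classes\<close>

lemma right_classes_le:
  assumes "\<And>P. P \<subseteq> fibre X \<pi> y \<Longrightarrow> finite P \<Longrightarrow>
    (\<And>x x'. x \<in> P \<Longrightarrow> x' \<in> P \<Longrightarrow> x \<noteq> x' \<Longrightarrow> \<not> right_equivalent X \<pi> x x') \<Longrightarrow> card P \<le> D"
  shows "finite (right_classes X \<pi> y) \<and> num_right_classes X \<pi> y \<le> D"
proof (rule ccontr)
  let ?R = "{(x, x'). x \<in> fibre X \<pi> y \<and> x' \<in> fibre X \<pi> y \<and> right_equivalent X \<pi> x x'}"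
  assume neg: "\<not> ?thesis"
  obtain C where C: "C \<subseteq> right_classes X \<pi> y" "finite C" "card C = Suc D"
  proof (cases "finite (right_classes X \<pi> y)")
    case True
    then have "Suc D \<le> card (right_classes X \<pi> y)"
      using neg by (simp add: num_right_classes_def)
    then show ?thesis using that by (meson obtain_subset_with_card_n)
  next
    case False
    then show ?thesis using that infinite_arbitrarily_large by blast
  qed
  note eqv = right_equivalent_fibre_equiv[of y]
  define rep where "rep c = (SOME x. x \<in> c)" for c :: "(int \<Rightarrow> 'a) set"
  have rep: "rep c \<in> c" if "c \<in> C" for c
  proof -
    have "c \<noteq> {}" using that C(1) in_quotient_imp_non_empty[OF eqv]
      unfolding right_classes_def by blast
    then show ?thesis unfolding rep_def by (simp add: some_in_eq)
  qed
  have eq: "c = c'" if "c \<in> C" "c' \<in> C" "(rep c, rep c') \<in> ?R" for c c'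
    using quotient_eq_iff[OF eqv, of c c' "rep c" "rep c'"] that rep C(1)
    unfolding right_classes_def by blast
  have fib: "rep ` C \<subseteq> fibre X \<pi> y"
    using rep C(1) in_quotient_imp_subset[OF eqv] unfolding right_classes_def by blast
  have refl: "(x, x) \<in> ?R" if "x \<in> fibre X \<pi> y" for x
    using eqv that unfolding equiv_def refl_on_def by blast
  have "inj_on rep C"
  proof (rule inj_onI)
    fix c c' assume c: "c \<in> C" "c' \<in> C" "rep c = rep c'"
    then have "(rep c, rep c') \<in> ?R" using refl[of "rep c"] fib by auto
    then show "c = c'" by (rule eq[OF c(1,2)])
  qed
  then have "card (rep ` C) = Suc D" using C(3) by (simp add: card_image)
  moreover have "card (rep ` C) \<le> D"
  proof (rule assms[OF fib])
    show "finite (rep ` C)" using C(2) by simp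
    fix x x' assume "x \<in> rep ` C" "x' \<in> rep ` C" "x \<noteq> x'"
    then show "\<not> right_equivalent X \<pi> x x'" using eq fib by blast
  qed
  ultimately show False by simp
qed

text \<open>Among more than \<open>D\<close> points of the fibre, two are rerouted through the same state of any given block,
  hence can be bridged in both directions from times before the block. Pairwise inequivalent points
  of a finite set have a common time from which no such mutual bridges start.\<close>

lemma right_classes_le_block_size:
  assumes blocks: "\<And>m. \<exists>a n b M. tblock y a n b M \<and> m \<le> a \<and> finite M \<and> card M \<le> D"
  shows "finite (right_classes X \<pi> y) \<and> num_right_classes X \<pi> y \<le> D"
proof (rule right_classes_le, rule ccontr)
  fix P assume P: "P \<subseteq> fibre X \<pi> y" "finite P" "\<not> card P \<le> D"
    and ineq: "\<And>x x'. x \<in> P \<Longrightarrow> x' \<in> P \<Longrightarrow> x \<noteq> x' \<Longrightarrow> \<not> right_equivalent X \<pi> x x'"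
  have PX: "x \<in> X" "\<pi> x = y" if "x \<in> P" for x using P(1) that by (auto simp: fibre_def)
  define meets where "meets m x x' \<longleftrightarrow> (\<exists>b. reach y m b (state x m) (state x' b))" for m x x'
  have mono: "meets m x x'" if "meets m' x x'" "m \<le> m'" "x \<in> P" for m m' x x'
  proof -
    have "reach y m m' (state x m) (state x m')"
      using reach_point[OF that(2) over_fibre[OF PX[OF that(3)]]] .
    then show ?thesis using that(1) reach_trans unfolding meets_def by blast
  qed
  define E where "E = {e \<in> P \<times> P. fst e \<noteq> snd e}"
  have "\<forall>e\<in>E. \<exists>m. \<not> meets m (fst e) (snd e) \<or> \<not> meets m (snd e) (fst e)"
  proof
    fix e assume "e \<in> E"
    then have e: "fst e \<in> P" "snd e \<in> P" "fst e \<noteq> snd e" by (auto simp: E_def)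
    show "\<exists>m. \<not> meets m (fst e) (snd e) \<or> \<not> meets m (snd e) (fst e)"
      using ineq[OF e] right_to_iff[OF PX(1)[OF e(1)] PX(1)[OF e(2)] PX(2)[OF e(1)] PX(2)[OF e(2)]]
        right_to_iff[OF PX(1)[OF e(2)] PX(1)[OF e(1)] PX(2)[OF e(2)] PX(2)[OF e(1)]]
      unfolding right_equivalent_def meets_def by blast
  qed
  from bchoice[OF this] obtain f where
    f: "\<And>e. e \<in> E \<Longrightarrow> \<not> meets (f e) (fst e) (snd e) \<or> \<not> meets (f e) (snd e) (fst e)"
    by blast
  define m where "m = Max (insert 0 (f ` (P \<times> P)))"
  have fm: "f e \<le> m" if "e \<in> P \<times> P" for e
    unfolding m_def using P(2) that by (intro Max_ge) auto
  obtain a n b M where B: "tblock y a n b M" "m \<le> a" "finite M" "card M \<le> D"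
    using blocks by blast
  have ab: "a \<le> b" using tblock_order[OF B(1)] by simp
  have "\<forall>x\<in>P. \<exists>r. r \<in> M \<and> reach y a n (state x a) r \<and> reach y n b r (state x b)"
    using tblock_through[OF B(1)] reach_point[OF ab over_fibre[OF PX]] by blast
  from bchoice[OF this] obtain g where g: "\<And>x. x \<in> P \<Longrightarrow> g x \<in> M \<and>
      reach y a n (state x a) (g x) \<and> reach y n b (g x) (state x b)"
    by blast
  have "card (g ` P) \<le> card M" using g B(3) by (intro card_mono) auto
  then have "\<not> inj_on g P" using B(4) P(3) by (intro pigeonhole) simp
  then obtain x x' where x: "x \<in> P" "x' \<in> P" "x \<noteq> x'" "g x = g x'"
    unfolding inj_on_def by blast
  have "meets a x x'" "meets a x' x"
    unfolding meets_def using g[OF x(1)] g[OF x(2)] x(4) reach_trans by metis+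
  then have "meets (f (x, x')) x x'" "meets (f (x, x')) x' x"
    using mono fm[of "(x, x')"] B(2) x by (meson SigmaI order_trans)+
  then show False using f[of "(x, x')"] x by (simp add: E_def)
qed

lemma finite_right_classes: "finite (right_classes X \<pi> y)"
proof -
  have "\<exists>a n b M. tblock y a n b M \<and> m \<le> a \<and> finite M \<and> card M \<le> card states" for m
    using tblock_states[of m m m] finite_states by blast
  then show ?thesis using right_classes_le_block_size by blast
qed

text \<open>Every point of the fibre gets from time \<open>0\<close> to its representative by some time \<open>n\<close>, uniform because
  there are finitely many states, and back later. If on all intervals \<open>[- k, n + k]\<close> some passage
  could not be rerouted through the states of the representatives at \<open>n\<close>, a cluster point of these
  passages would be a point of the fibre that its representative never reaches.\<close>

lemma tblock_of_class_representatives: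
  assumes y: "y \<in> \<pi> ` X"
  shows "\<exists>a n b M. tblock y a n b M \<and> finite M \<and> card M \<le> num_right_classes X \<pi> y"
proof -
  let ?R = "{(x, x'). x \<in> fibre X \<pi> y \<and> x' \<in> fibre X \<pi> y \<and> right_equivalent X \<pi> x x'}"
  note eqv = right_equivalent_fibre_equiv[of y]
  define rep where "rep c = (SOME x. x \<in> c)" for c :: "(int \<Rightarrow> 'a) set"
  define P where "P = rep ` right_classes X \<pi> y"
  have P: "finite P" "card P \<le> num_right_classes X \<pi> y"
    unfolding P_def num_right_classes_def using finite_right_classes card_image_le by blast+
  have rep: "rep c \<in> c" if "c \<in> right_classes X \<pi> y" for c
  proof -
    have "c \<noteq> {}" using that in_quotient_imp_non_empty[OF eqv]
      unfolding right_classes_def by blast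
    then show ?thesis unfolding rep_def by (simp add: some_in_eq)
  qed
  have PR: "\<exists>p\<in>P. (x, p) \<in> ?R" if "x \<in> fibre X \<pi> y" for x
  proof -
    have "?R `` {x} \<in> right_classes X \<pi> y"
      unfolding right_classes_def using that by (rule quotientI)
    then show ?thesis using rep unfolding P_def by blast
  qed
  have PX: "x \<in> X \<and> \<pi> x = y \<and> p \<in> X \<and> \<pi> p = y" if "(x, p) \<in> ?R" for x p
    using that by (auto simp: fibre_def)
  have rto: "\<forall>a. \<exists>b. reach y a b (state x a) (state p b)" "\<forall>a. \<exists>b. reach y a b (state p a) (state x b)"
    if "(x, p) \<in> ?R" for x p
    using that right_to_iff[of x p y] right_to_iff[of p x y] PX[OF that]
    by (simp_all add: right_equivalent_def)
  \<comment> \<open>\<open>n\<close> will be one time by which every point of the fibre can have reached its representative.\<close>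
  have "\<forall>e. \<exists>b. \<forall>x. (x, snd e) \<in> ?R \<and> state x 0 = fst e \<longrightarrow> reach y 0 b (fst e) (state (snd e) b)"
  proof
    fix e
    show "\<exists>b. \<forall>x. (x, snd e) \<in> ?R \<and> state x 0 = fst e \<longrightarrow> reach y 0 b (fst e) (state (snd e) b)"
    proof (cases "\<exists>x. (x, snd e) \<in> ?R \<and> state x 0 = fst e")
      case True
      then obtain x where x: "(x, snd e) \<in> ?R" "state x 0 = fst e" by blast
      then show ?thesis using rto(1)[OF x(1)] unfolding x(2)[symmetric] by blast
    qed blast
  qed
  from choice[OF this] obtain B where B: "\<And>e x. (x, snd e) \<in> ?R \<Longrightarrow> state x 0 = fst e \<Longrightarrow>
      reach y 0 (B e) (fst e) (state (snd e) (B e))"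
    by blast
  define n where "n = Max (insert 0 (B ` (states \<times> P)))"
  have n: "0 \<le> n" "\<And>e. e \<in> states \<times> P \<Longrightarrow> B e \<le> n"
    unfolding n_def using P(1) finite_states by (auto intro!: Max_ge)
  have to_rep: "reach y 0 n (state x 0) (state p n)" if "(x, p) \<in> ?R" "p \<in> P" for x p
  proof -
    let ?e = "(state x 0, p)"
    have "reach y 0 (B ?e) (state x 0) (state p (B ?e))" using B[of x ?e] that(1) by simp
    moreover have "B ?e \<le> n" using n(2)[of ?e] that PX[OF that(1)] state_in_states by blast
    then have "reach y (B ?e) n (state p (B ?e)) (state p n)"
      using PX[OF that(1)] by (intro reach_point over_fibre) auto
    ultimately show ?thesis by (rule reach_trans)
  qed
  define M where "M = (\<lambda>p. state p n) ` P"
  have M: "finite M" "card M \<le> num_right_classes X \<pi> y"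
    unfolding M_def using P card_image_le[OF P(1), of "\<lambda>p. state p n"] by auto
  have "\<exists>k::nat. tblock y (- int k) n (n + int k) M"
  proof (rule ccontr)
    assume neg: "\<nexists>k::nat. tblock y (- int k) n (n + int k) M"
    have "\<forall>k::nat. \<exists>x. over y (- int k) (n + int k) x \<and>
      (\<forall>r\<in>M. reach y (- int k) n (state x (- int k)) r \<longrightarrow>
        \<not> reach y n (n + int k) r (state x (n + int k)))"
    proof
      fix k :: nat
      have "\<not> tblock y (- int k) n (n + int k) M" using neg by blast
      moreover have "- int k \<le> n" "n \<le> n + int k" using n(1) by simp_all
      ultimately obtain s t where st: "reach y (- int k) (n + int k) s t"
        and no: "\<not> (\<exists>r\<in>M. reach y (- int k) n s r \<and> reach y n (n + int k) r t)"
        unfolding tblock_def by blast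
      obtain x where x: "over y (- int k) (n + int k) x" "state x (- int k) = s"
        "state x (n + int k) = t"
        using st unfolding reach_def by blast
      show "\<exists>x. over y (- int k) (n + int k) x \<and>
        (\<forall>r\<in>M. reach y (- int k) n (state x (- int k)) r \<longrightarrow>
          \<not> reach y n (n + int k) r (state x (n + int k)))"
        using no x(1) unfolding x(2)[symmetric] x(3)[symmetric] by blast
    qed
    from choice[OF this] obtain f where f: "\<And>k. over y (- int k) (n + int k) (f k)"
      "\<And>k r. r \<in> M \<Longrightarrow> reach y (- int k) n (state (f k) (- int k)) r \<Longrightarrow>
        \<not> reach y n (n + int k) r (state (f k) (n + int k))"
      by blast
    have "f k \<in> X" for k using f(1)[of k] by (simp add: over_def)
    then obtain x where x: "x \<in> X" and near: "\<And>n. \<exists>k\<ge>n. \<forall>i. \<bar>i\<bar> \<le> int n \<longrightarrow>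
      f k i = x i \<and> \<pi> (f k) i = \<pi> x i \<and> state (f k) i = state x i"
      using cluster_point_code[of f] by metis
    have "\<pi> x i = y i" for i
    proof -
      obtain k where k: "k \<ge> nat \<bar>i\<bar>" "\<pi> (f k) i = \<pi> x i" using near[of "nat \<bar>i\<bar>"] by auto
      moreover have "- int k \<le> i \<and> i \<le> n + int k" using k(1) n(1) by linarith
      ultimately show ?thesis using f(1)[of k] unfolding over_def by metis
    qed
    then have "x \<in> fibre X \<pi> y" using x by (auto simp: fibre_def)
    then obtain p where p: "p \<in> P" "(x, p) \<in> ?R" using PR by blast
    obtain q where q: "reach y n q (state p n) (state x q)" using rto(2)[OF p(2)] by blast
    then have nq: "n \<le> q" by (rule reach_le)
    obtain k where k: "k \<ge> nat q" "\<And>i. \<bar>i\<bar> \<le> int (nat q) \<Longrightarrow> state (f k) i = state x i"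
      using near[of "nat q"] by blast
    have at: "state (f k) 0 = state x 0" "state (f k) q = state x q"
      using k(2)[of 0] k(2)[of q] nq n(1) by auto
    have "reach y (- int k) 0 (state (f k) (- int k)) (state x 0)"
      using reach_point[OF _ over_mono[OF f(1)[of k]], of "- int k" 0] n(1) at(1) by simp
    then have in_M: "reach y (- int k) n (state (f k) (- int k)) (state p n)"
      using to_rep[OF p(2,1)] by (rule reach_trans)
    have "reach y q (n + int k) (state x q) (state (f k) (n + int k))"
      using reach_point[OF _ over_mono[OF f(1)[of k]], of q "n + int k"] n(1) nq k(1) at(2) by simp
    with q have "reach y n (n + int k) (state p n) (state (f k) (n + int k))" by (rule reach_trans)
    then show False using f(2)[OF _ in_M] p(1) unfolding M_def by blast
  qed
  then show ?thesis using M by blast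
qed

lemma min_depth_le_num:
  assumes "y \<in> \<pi> ` X"
  shows "min_depth \<le> num_right_classes X \<pi> y"
  using tblock_of_class_representatives[OF assms] min_depth_le[OF assms] by (meson order_trans)

text \<open>By irreducibility one can append copies of the block to the right one after another; the points
  obtained agree on longer and longer left rays, so a cluster point keeps all the copies.\<close>

lemma exists_recurrent_mblocks:
  "\<exists>y\<in>\<pi> ` X. \<forall>m. \<exists>a n b M. mblock y a n b M \<and> m \<le> a"
proof -
  obtain x0 a n b M where x0: "x0 \<in> X" and B: "mblock (\<pi> x0) a n b M"
    using mblock_exists by blast
  \<comment> \<open>A pair consists of a point and a time up to which it is final. The new block ends \<open>N\<close> before that
    time, so that the windows determining its image are final too.\<close>
  define Q where "Q e e' \<longleftrightarrow> snd e < snd e' \<and> (\<forall>i\<le>snd e. fst e' i = fst e i) \<and>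
    (\<exists>d. snd e < a + d \<and> b + d + N \<le> snd e' \<and> mblock (\<pi> (fst e')) (a + d) (n + d) (b + d) M)"
    for e e' :: "(int \<Rightarrow> 'a) \<times> int"
  have step: "\<exists>e'. fst e' \<in> X \<and> Q e e'" if e: "fst e \<in> X" for e
  proof -
    obtain z d where z: "z \<in> X" "snd e < a + d" "\<And>i. i \<le> snd e \<Longrightarrow> z i = fst e i"
      "\<And>i. a \<le> i \<Longrightarrow> \<pi> z (i + d) = \<pi> x0 i"
      using connect_points[OF e x0, of "snd e" a] by metis
    have "mblock (\<pi> z) (a + d) (n + d) (b + d) M"
      using mblock_cong[of a b "\<pi> z" d "\<pi> x0" n M] z(4) B by simp
    then show ?thesis
      using z by (intro exI[of _ "(z, max (snd e + 1) (b + d + N))"]) (auto simp: Q_def)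
  qed
  obtain f where f: "\<And>k::nat. fst (f k) \<in> X" "\<And>k. Q (f k) (f (Suc k))"
    using dependent_nat_choice[of "\<lambda>_ e. fst e \<in> X" "\<lambda>_. Q"] step x0 by (metis fst_conv)
  have increasing: "snd (f k) \<le> snd (f (k + j))" for k j
  proof (induction j)
    case (Suc j)
    then show ?case using f(2)[of "k + j"] unfolding Q_def by simp
  qed simp
  have growth: "snd (f 0) + int k \<le> snd (f k)" for k
  proof (induction k)
    case (Suc k)
    then show ?case using f(2)[of k] unfolding Q_def by auto
  qed simp
  have stable: "fst (f (k + j)) i = fst (f k) i" if "i \<le> snd (f k)" for k j i
  proof (induction j)
    case (Suc j)
    have "i \<le> snd (f (k + j))" using that increasing[of k j] by simp
    then show ?case using f(2)[of "k + j"] Suc unfolding Q_def by simp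
  qed simp
  obtain z where z: "z \<in> X" "\<And>n. \<exists>k\<ge>n. \<forall>i. \<bar>i\<bar> \<le> int n \<longrightarrow>
      fst (f k) i = z i \<and> \<pi> (fst (f k)) i = \<pi> z i \<and> state (fst (f k)) i = state z i"
    using cluster_point_code[of "\<lambda>k. fst (f k)"] f(1) by metis
  have limit: "z i = fst (f k) i" if "i \<le> snd (f k)" for k i
  proof -
    obtain l where l: "l \<ge> max k (nat \<bar>i\<bar>)" "fst (f l) i = z i"
      using z(2)[of "max k (nat \<bar>i\<bar>)"] by auto
    then show ?thesis using stable[OF that, of "l - k"] by simp
  qed
  have "\<exists>a n b M. mblock (\<pi> z) a n b M \<and> m \<le> a" for m
  proof -
    define k where "k = nat (m - snd (f 0))"
    obtain d where d: "snd (f k) < a + d" "b + d + N \<le> snd (f (Suc k))"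
      "mblock (\<pi> (fst (f (Suc k)))) (a + d) (n + d) (b + d) M"
      using f(2)[of k] unfolding Q_def by blast
    have "\<pi> z i = \<pi> (fst (f (Suc k))) i" if "i \<le> b + d" for i
      by (rule code_cong[OF z(1) f(1)], rule state_cong, rule limit) (use that d(2) in linarith)
    then have "mblock (\<pi> z) (a + d) (n + d) (b + d) M"
      using mblock_cong[of "a + d" "b + d" "\<pi> z" 0 "\<pi> (fst (f (Suc k)))" "n + d" M] d(3) by simp
    moreover have "m \<le> snd (f 0) + int k" unfolding k_def by simp
    then have "m \<le> a + d" using d(1) growth[of k] by linarith
    ultimately show ?thesis by blast
  qed
  then show ?thesis using z(1) by blast
qed

text \<open>Blocks far to the right bound the number of classes from above, and the transition block built from
  representatives bounds it from below.\<close>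

lemma num_eq_min_depth:
  assumes y: "y \<in> \<pi> ` X" and B: "\<And>m. \<exists>a n b M. mblock y a n b M \<and> m \<le> a"
  shows "num_right_classes X \<pi> y = min_depth"
proof -
  have "\<exists>a n b M. tblock y a n b M \<and> m \<le> a \<and> finite M \<and> card M \<le> min_depth" for m
    using B[of m] unfolding mblock_def by (metis order_refl)
  then show ?thesis
    using right_classes_le_block_size[of y min_depth] min_depth_le_num[OF y] by simp
qed

lemma class_degree_eq_min_depth: "class_degree X (\<pi> ` X) \<pi> = min_depth"
proof -
  obtain y where y: "y \<in> \<pi> ` X" "\<And>m. \<exists>a n b M. mblock y a n b M \<and> m \<le> a"
    using exists_recurrent_mblocks by blast
  show ?thesis
    unfolding class_degree_def
  proof (rule cInf_eq_minimum)
    show "min_depth \<in> num_right_classes X \<pi> ` \<pi> ` X"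
      using num_eq_min_depth[OF y] y(1) by (metis imageI)
  qed (use min_depth_le_num in auto)
qed

section \<open>Minimal blocks in every point\<close>

definition mblocks_everywhere :: bool where
  "mblocks_everywhere \<longleftrightarrow> (\<forall>y\<in>\<pi> ` X. \<exists>a n b M. mblock y a n b M)"

text \<open>A cluster point of the translates of \<open>x\<close> in one direction contains a minimal block as well; the
  translates that agree with it there show this block at far away places of \<open>y\<close>.\<close>

lemma mblocks_unbounded:
  assumes K: "mblocks_everywhere" and y: "y \<in> \<pi> ` X"
  shows "\<exists>a n b M. mblock y a n b M \<and> m \<le> a"
    and "\<exists>a n b M. mblock y a n b M \<and> b \<le> m"
proof -
  obtain x where x: "x \<in> X" "y = \<pi> x" using y by blast
  have *: "\<exists>a n b M (k::nat). mblock y (a + e * k) (n + e * k) (b + e * k) M \<and> \<bar>a\<bar> + \<bar>b\<bar> + \<bar>m\<bar> \<le> k"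
    for e :: int
  proof -
    have "translate (e * int k) x \<in> X" for k by (rule translate_in[OF x(1)])
    then obtain z where z: "z \<in> X" "\<And>n. \<exists>k\<ge>n. \<forall>i. \<bar>i\<bar> \<le> int n \<longrightarrow>
        \<pi> (translate (e * int k) x) i = \<pi> z i"
      using cluster_point_code[of "\<lambda>k. translate (e * int k) x"] by metis
    obtain a n b M where B: "mblock (\<pi> z) a n b M"
      using K z(1) unfolding mblocks_everywhere_def by blast
    define l where "l = nat (\<bar>a\<bar> + \<bar>b\<bar> + \<bar>m\<bar>)"
    obtain k where k: "k \<ge> l" "\<And>i. \<bar>i\<bar> \<le> int l \<Longrightarrow> \<pi> (translate (e * int k) x) i = \<pi> z i"
      using z(2)[of l] by blast
    have "y (i + e * int k) = \<pi> z i" if "a \<le> i" "i \<le> b" for i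
      using k(2)[of i] that
      unfolding code_translate[OF x(1)] x(2) by (simp add: l_def translate_def)
    then have "mblock y (a + e * k) (n + e * k) (b + e * k) M"
      using mblock_cong[of a b y "e * k" "\<pi> z" n M] B by simp
    moreover have "\<bar>a\<bar> + \<bar>b\<bar> + \<bar>m\<bar> \<le> k" using k(1) by (simp add: l_def)
    ultimately show ?thesis by blast
  qed
  obtain a n b M k where "mblock y (a + int k) (n + int k) (b + int k) M" "\<bar>a\<bar> + \<bar>b\<bar> + \<bar>m\<bar> \<le> int k"
    using *[of 1] by auto
  moreover from this(2) have "m \<le> a + int k" by linarith
  ultimately show "\<exists>a n b M. mblock y a n b M \<and> m \<le> a" by blast
  obtain a n b M k where "mblock y (a - int k) (n - int k) (b - int k) M" "\<bar>a\<bar> + \<bar>b\<bar> + \<bar>m\<bar> \<le> int k"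
    using *[of "-1"] by auto
  moreover from this(2) have "b - int k \<le> m" by linarith
  ultimately show "\<exists>a n b M. mblock y a n b M \<and> b \<le> m" by blast
qed

lemma constant_iff_mblocks_everywhere:
  "constant_class_to_one X (\<pi> ` X) \<pi> \<longleftrightarrow> mblocks_everywhere"
proof
  assume const: "constant_class_to_one X (\<pi> ` X) \<pi>"
  show mblocks_everywhere
    unfolding mblocks_everywhere_def
  proof
    fix y assume y: "y \<in> \<pi> ` X"
    obtain a n b M where B: "tblock y a n b M" "finite M" "card M \<le> num_right_classes X \<pi> y"
      using tblock_of_class_representatives[OF y] by blast
    have "num_right_classes X \<pi> y = min_depth"
      using const y unfolding constant_class_to_one_def class_degree_eq_min_depth by blast
    then have "mblock y a n b M" using B min_depth_le[OF y B(1,2)] by (simp add: mblock_def)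
    then show "\<exists>a n b M. mblock y a n b M" by blast
  qed
next
  assume K: mblocks_everywhere
  show "constant_class_to_one X (\<pi> ` X) \<pi>"
    unfolding constant_class_to_one_def class_degree_eq_min_depth
    using num_eq_min_depth mblocks_unbounded(1)[OF K] by blast
qed

text \<open>The points leave a block in their common left ray through one state \<open>r\<close>. Both can pass any block
  further to the right through a state reachable from \<open>r\<close>, and there is only one such state.\<close>

lemma right_class_closing_if_mblocks_everywhere:
  assumes K: mblocks_everywhere
  shows "right_class_closing X \<pi>"
proof -
  have "right_to X \<pi> x x'"
    if X: "x \<in> X" "x' \<in> X" and left: "left_asymptotic x x'" and fib: "\<pi> x = \<pi> x'" for x x'
  proof -
    define y where "y = \<pi> x"
    have y: "y \<in> \<pi> ` X" "\<pi> x = y" "\<pi> x' = y" using X fib by (auto simp: y_def)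
    obtain l where l: "\<And>i. i \<le> l \<Longrightarrow> x i = x' i" using left unfolding left_asymptotic_def by blast
    obtain a n b M where B: "mblock y a n b M" "b \<le> l - N"
      using mblocks_unbounded(2)[OF K y(1)] by blast
    have o: "a \<le> n" "n \<le> b" using B(1) by (auto simp: mblock_def dest: tblock_order)
    have same: "state x b = state x' b" by (rule state_cong, rule l) (use B(2) in linarith)
    have "reach y a b (state x a) (state x b)"
      using o X y by (intro reach_point over_fibre) auto
    then obtain r where r: "r \<in> M" "reach y n b r (state x b)"
      using tblock_through B(1) unfolding mblock_def by blast
    have "\<exists>d. reach y m d (state x m) (state x' d)" for m
    proof -
      obtain a' n' b' M' where B': "mblock y a' n' b' M'" "max m b \<le> a'"
        using mblocks_unbounded(1)[OF K y(1)] by blast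
      have o': "a' \<le> n'" "n' \<le> b'" using B'(1) by (auto simp: mblock_def dest: tblock_order)
      have "reach y a' b' (state x a') (state x b')" "reach y a' b' (state x' a') (state x' b')"
        using o' X y by (auto intro: reach_point over_fibre)
      then obtain t t' where t: "t \<in> M'" "reach y a' n' (state x a') t"
        and t': "t' \<in> M'" "reach y a' n' (state x' a') t'" "reach y n' b' t' (state x' b')"
        using tblock_through B'(1) unfolding mblock_def by metis
      have go: "reach y b a' (state x b) (state x a')" "reach y b a' (state x' b) (state x' a')"
        "reach y m a' (state x m) (state x a')"
        using B'(2) X y by (auto intro!: reach_point over_fibre)
      have "reach y n n' r t" using r(2) go(1) t(2) by (blast intro: reach_trans)
      moreover have "reach y n n' r t'"
        using r(2) go(2) t'(2) unfolding same by (blast intro: reach_trans)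
      ultimately have "t = t'"
        using mblock_reach_bijective(2)[OF y(1) B(1) B'(1) _ r(1) t(1) t'(1)] B'(2) by simp
      then have "reach y m b' (state x m) (state x' b')"
        using go(3) t(2) t'(3) by (blast intro: reach_trans)
      then show ?thesis by blast
    qed
    then show ?thesis using right_to_iff[OF X y(2,3)] by blast
  qed
  then show ?thesis
    unfolding right_class_closing_def right_equivalent_def left_asymptotic_def by metis
qed

text \<open>The bijections between blocks lift \<open>y\<close> to the left from a block near the right ray of \<open>x\<close> down to
  blocks as far to the left as desired; a cluster point of these lifts lies over all of \<open>y\<close>.\<close>

lemma left_continuing_if_mblocks_everywhere:
  assumes K: mblocks_everywhere
  shows "left_continuing X (\<pi> ` X) \<pi>"
  unfolding left_continuing_def
proof (intro ballI impI)
  fix x y assume x: "x \<in> X" and y: "y \<in> \<pi> ` X" and "right_asymptotic y (\<pi> x)"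
  then obtain l where l: "\<And>i. l \<le> i \<Longrightarrow> y i = \<pi> x i" unfolding right_asymptotic_def by blast
  obtain a' n' b' M' where B': "mblock y a' n' b' M'" "l \<le> a'"
    using mblocks_unbounded(1)[OF K y] by blast
  have o': "a' \<le> n'" "n' \<le> b'" using B'(1) by (auto simp: mblock_def dest: tblock_order)
  have "over y a' b' x" using x l B'(2) by (auto simp: over_def)
  then have "reach y a' b' (state x a') (state x b')" using o' by (intro reach_point) auto
  then obtain t where t: "t \<in> M'" "reach y n' b' t (state x b')"
    using tblock_through B'(1) unfolding mblock_def by blast
  have "\<exists>z\<in>X. (\<forall>i\<ge>- int k. \<pi> z i = y i) \<and> (\<forall>i\<ge>b'. z i = x i)" for k
  proof -
    obtain a n b M where B: "mblock y a n b M" "b \<le> min a' (- int k)"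
      using mblocks_unbounded(2)[OF K y] by blast
    have o: "a \<le> n" "n \<le> b" using B(1) by (auto simp: mblock_def dest: tblock_order)
    obtain s where "reach y n n' s t"
      using mblock_reach_bijective(1)[OF y B(1) B'(1) _ t(1)] B(2) by auto
    then have "reach y n b' s (state x b')" using t(2) by (rule reach_trans)
    then obtain w where w: "over y n b' w" "state w b' = state x b'"
      unfolding reach_def by blast
    have W: "w \<in> X" using w(1) by (simp add: over_def)
    note J = join_at_equal_states[OF W x w(2)]
    have "\<pi> (join w b' x) i = y i" if "- int k \<le> i" for i
    proof (cases "i \<le> b'")
      case True
      then show ?thesis using J(6)[of i] w(1) that B(2) o unfolding over_def by simp
    next
      case False
      then show ?thesis using J(7)[of i] l[of i] o' B'(2) by simp
    qed
    moreover have "join w b' x i = x i" if "b' \<le> i" for i using J(3)[of i] that N_nonneg by simp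
    ultimately show ?thesis using J(1) by blast
  qed
  then obtain f where f: "\<And>k::nat. f k \<in> X" "\<And>k i. - int k \<le> i \<Longrightarrow> \<pi> (f k) i = y i"
    "\<And>k i. b' \<le> i \<Longrightarrow> f k i = x i"
    by metis
  obtain z where z: "z \<in> X" "\<And>n. \<exists>k\<ge>n. \<forall>i. \<bar>i\<bar> \<le> int n \<longrightarrow>
      f k i = z i \<and> \<pi> (f k) i = \<pi> z i \<and> state (f k) i = state z i"
    using cluster_point_code[of f] f(1) by metis
  have "\<pi> z i = y i \<and> (b' \<le> i \<longrightarrow> z i = x i)" for i
  proof -
    obtain k where k: "k \<ge> nat \<bar>i\<bar>" "f k i = z i" "\<pi> (f k) i = \<pi> z i"
      using z(2)[of "nat \<bar>i\<bar>"] by auto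
    then show ?thesis using f(2)[of k i] f(3)[of i k] by auto
  qed
  then show "\<exists>x'\<in>X. \<pi> x' = y \<and> right_asymptotic x' x"
    using z(1) unfolding right_asymptotic_def by (intro bexI[of _ z]) auto
qed

text \<open>Left continuing moves a set \<open>P\<close> of inequivalent points from the fibre of \<open>y\<close> to the fibre of a point
  \<open>y'\<close> that agrees with \<open>y\<close> from time \<open>0\<close> on and has a minimal block to the left. Right equivalence
  is decided by right tails and so is unaffected, but two lifts that share a state in the block are
  spliced to a point that is left asymptotic to one of them and equals the other on the right.\<close>

lemma mblocks_everywhere_if_closing_continuing:
  assumes closing: "right_class_closing X \<pi>" and cont: "left_continuing X (\<pi> ` X) \<pi>"
  shows mblocks_everywhere
proof -
  have "num_right_classes X \<pi> y \<le> min_depth" if y: "y \<in> \<pi> ` X" for y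
  proof (rule conjunct2[OF right_classes_le], rule ccontr)
    fix P assume P: "P \<subseteq> fibre X \<pi> y" "finite P" "\<not> card P \<le> min_depth"
      and ineq: "\<And>x x'. x \<in> P \<Longrightarrow> x' \<in> P \<Longrightarrow> x \<noteq> x' \<Longrightarrow> \<not> right_equivalent X \<pi> x x'"
    have PX: "x \<in> X" "\<pi> x = y" if "x \<in> P" for x using P(1) that by (auto simp: fibre_def)
    obtain x1 where x1: "x1 \<in> X" "\<pi> x1 = y" using y by blast
    obtain x0 a n b M where x0: "x0 \<in> X" and B0: "mblock (\<pi> x0) a n b M"
      using mblock_exists by blast
    obtain w0 c where w0: "w0 \<in> X" "\<And>i. i \<le> b \<Longrightarrow> \<pi> w0 i = \<pi> x0 i"
      "\<And>i. 0 \<le> i \<Longrightarrow> \<pi> w0 (i + c) = y i"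
      using connect_points[OF x0 x1(1), of b 0] x1(2) by metis
    define y' where "y' = translate c (\<pi> w0)"
    have "y' = \<pi> (translate c w0)" unfolding y'_def by (rule code_translate[OF w0(1), symmetric])
    then have y'_in: "y' \<in> \<pi> ` X" using translate_in[OF w0(1)] by blast
    have y'_eq: "y' i = y i" if "0 \<le> i" for i
      using w0(3)[OF that] by (simp add: y'_def translate_def)
    note y' = y'_in y'_eq
    have B: "mblock y' (a + (- c)) (n + (- c)) (b + (- c)) M"
      using mblock_cong[of a b y' "- c" "\<pi> x0" n M] B0 w0(2) by (simp add: y'_def translate_def)
    then have T: "tblock y' (a - c) (n - c) (b - c) M" "finite M" "card M = min_depth"
      by (simp_all add: mblock_def)
    have o: "a - c \<le> b - c" using tblock_order[OF T(1)] by simp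
    have "\<exists>x'\<in>X. \<pi> x' = y' \<and> right_asymptotic x' x" if "x \<in> P" for x
    proof -
      have "right_asymptotic y' (\<pi> x)"
        using y'(2) PX[OF that] unfolding right_asymptotic_def by blast
      then show ?thesis using cont PX[OF that] y'(1) unfolding left_continuing_def by blast
    qed
    then obtain f where f: "\<And>x. x \<in> P \<Longrightarrow> f x \<in> X \<and> \<pi> (f x) = y' \<and> right_asymptotic (f x) x"
      by metis
    have "\<exists>r\<in>M. reach y' (a - c) (n - c) (state (f x) (a - c)) r \<and>
        reach y' (n - c) (b - c) r (state (f x) (b - c))" if "x \<in> P" for x
      using f[OF that] by (intro tblock_through[OF T(1)] reach_point[OF o] over_fibre) auto
    then obtain g where g: "\<And>x. x \<in> P \<Longrightarrow> g x \<in> M \<and>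
        reach y' (a - c) (n - c) (state (f x) (a - c)) (g x) \<and>
        reach y' (n - c) (b - c) (g x) (state (f x) (b - c))"
      by metis
    have "card (g ` P) \<le> card M" using g T(2) by (intro card_mono) auto
    then have "\<not> inj_on g P" using T(3) P(3) by (intro pigeonhole) simp
    then obtain u v where uv: "u \<in> P" "v \<in> P" "u \<noteq> v" "g u = g v"
      unfolding inj_on_def by blast
    have equiv: "right_to X \<pi> u v" if uv: "u \<in> P" "v \<in> P" "g u = g v" for u v
    proof -
      have fX: "f u \<in> X" "f v \<in> X" "\<pi> (f u) = y'" "\<pi> (f v) = y'" using f uv by blast+
      have vu: "reach y' (a - c) (b - c) (state (f v) (a - c)) (state (f u) (b - c))"
        using g[OF uv(1)] g[OF uv(2)] uv(3) reach_trans by metis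
      obtain z where z: "z \<in> X"
        "\<And>i. i \<le> a - c \<Longrightarrow> z i = f v i" "\<And>i. b - c \<le> i \<Longrightarrow> z i = f u i"
        and zc: "\<And>i. i \<le> a - c \<Longrightarrow> \<pi> z i = \<pi> (f v) i" "\<And>i. b - c \<le> i \<Longrightarrow> \<pi> z i = \<pi> (f u) i"
        "\<And>i. a - c \<le> i \<Longrightarrow> i \<le> b - c \<Longrightarrow> \<pi> z i = y' i"
        by (rule reach_between_points[OF fX(2,1) vu]) (rule that)
      have "\<pi> z i = y' i" for i
        using zc[of i] fX by (cases "i \<le> a - c"; cases "b - c \<le> i") auto
      then have zy: "\<pi> z = y'" by blast
      have "left_asymptotic z (f v)" using z(2) unfolding left_asymptotic_def by blast
      then have "right_to X \<pi> z (f v)"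
        using closing z(1) fX zy unfolding right_class_closing_def right_equivalent_def by metis
      \<comment> \<open>\<open>z\<close> follows \<open>f v\<close> on the left and \<open>f u\<close> on the right; closing bridges it back to \<open>f v\<close>.\<close>
      then have zv: "\<exists>e. reach y' d e (state z d) (state (f v) e)" for d
        using right_to_iff[OF z(1) fX(2) zy fX(4)] by blast
      obtain l where l: "\<And>i. l \<le> i \<Longrightarrow> f u i = u i"
        using f[OF uv(1)] unfolding right_asymptotic_def by blast
      obtain l' where l': "\<And>i. l' \<le> i \<Longrightarrow> f v i = v i"
        using f[OF uv(2)] unfolding right_asymptotic_def by blast
      define m where "m = max (max l l') (max 0 (b - c)) + N"
      have su: "state z i = state u i" if i: "m \<le> i" for i
      proof (rule state_cong)
        fix j assume "\<bar>j - i\<bar> \<le> N"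
        then have "b - c \<le> j" "l \<le> j" using i unfolding m_def by linarith+
        then show "z j = u j" using z(3) l by simp
      qed
      have sv: "state (f v) i = state v i" if "m \<le> i" for i
        by (rule state_cong, rule l') (use that in \<open>unfold m_def, linarith\<close>)
      have "\<exists>e. reach y d e (state u d) (state v e)" if d: "m \<le> d" for d
      proof -
        obtain e where e: "reach y' d e (state z d) (state (f v) e)" using zv by blast
        then have de: "d \<le> e" by (rule reach_le)
        have "reach y' d e = reach y d e"
          by (rule reach_cong, rule y'(2)) (use d N_nonneg in \<open>unfold m_def, linarith\<close>)
        then show ?thesis using e su[OF d] sv[of e] d de by auto
      qed
      then show ?thesis using right_toI_eventually[of u v y m] PX uv by blast
    qed
    show False
      using ineq[OF uv(1-3)] equiv[OF uv(1,2,4)] equiv[OF uv(2,1) uv(4)[symmetric]]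
      unfolding right_equivalent_def by blast
  qed
  then have "constant_class_to_one X (\<pi> ` X) \<pi>"
    unfolding constant_class_to_one_def class_degree_eq_min_depth
    using min_depth_le_num by (meson antisym)
  then show ?thesis using constant_iff_mblocks_everywhere by blast
qed

theorem closing_continuing_iff_mblocks_everywhere:
  "right_class_closing X \<pi> \<and> left_continuing X (\<pi> ` X) \<pi> \<longleftrightarrow> mblocks_everywhere"
  using right_class_closing_if_mblocks_everywhere left_continuing_if_mblocks_everywhere
    mblocks_everywhere_if_closing_continuing by blast

end

section \<open>Reflection\<close>

definition reflect :: "(int \<Rightarrow> 'a) \<Rightarrow> int \<Rightarrow> 'a" where
  "reflect x = (\<lambda>i. x (- i))"

definition reflect_code :: "((int \<Rightarrow> 'a) \<Rightarrow> int \<Rightarrow> 'b) \<Rightarrow> (int \<Rightarrow> 'a) \<Rightarrow> int \<Rightarrow> 'b" where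
  "reflect_code \<pi> = (\<lambda>x. reflect (\<pi> (reflect x)))"

lemma reflect_reflect [simp]: "reflect (reflect x) = x"
  by (simp add: reflect_def)

lemma reflect_eq_iff [simp]: "reflect x = reflect y \<longleftrightarrow> x = y"
  by (metis reflect_reflect)

lemma reflect_in_iff [simp]: "reflect x \<in> reflect ` X \<longleftrightarrow> x \<in> X"
  by (auto simp: image_iff)

lemma reflect_code_reflect [simp]: "reflect_code \<pi> (reflect x) = reflect (\<pi> x)"
  by (simp add: reflect_code_def)

lemma reflect_code_image: "reflect_code \<pi> ` reflect ` X = reflect ` \<pi> ` X"
  by (simp add: image_image)

lemma all_reflect: "(\<forall>x. P x) \<longleftrightarrow> (\<forall>x. P (reflect x))"
  by (metis reflect_reflect)

lemma ex_reflect: "(\<exists>x. P x) \<longleftrightarrow> (\<exists>x. P (reflect x))"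
  by (metis reflect_reflect)

lemma all_neg: "(\<forall>m::int. P m) \<longleftrightarrow> (\<forall>m. P (- m))"
  by (metis minus_minus)

lemma ex_neg: "(\<exists>m::int. P m) \<longleftrightarrow> (\<exists>m. P (- m))"
  by (metis minus_minus)

lemma left_asymptotic_reflect:
  "left_asymptotic (reflect x) (reflect x') \<longleftrightarrow> right_asymptotic x x'"
  unfolding left_asymptotic_def right_asymptotic_def reflect_def
  by (subst ex_neg, subst all_neg) simp

lemma right_asymptotic_reflect:
  "right_asymptotic (reflect x) (reflect x') \<longleftrightarrow> left_asymptotic x x'"
  using left_asymptotic_reflect[of "reflect x" "reflect x'"] by simp

lemma right_bridge_reflect:
  "right_bridge (reflect ` X) (reflect_code \<pi>) m (reflect x) (reflect x') (reflect z) \<longleftrightarrow>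
    left_bridge X \<pi> (- m) x x' z"
proof -
  have 1: "(\<forall>i\<le>m. reflect z i = reflect x i) \<longleftrightarrow> (\<forall>i\<ge>- m. z i = x i)"
    unfolding reflect_def by (subst all_neg) auto
  have 2: "(\<forall>i\<ge>- n. reflect z i = reflect x' i) \<longleftrightarrow> (\<forall>i\<le>n. z i = x' i)" for n
    unfolding reflect_def by (subst all_neg) auto
  have 3: "m < - n \<longleftrightarrow> n < - m" for n by linarith
  have "(\<exists>n>m. (\<forall>i\<le>m. reflect z i = reflect x i) \<and> (\<forall>i\<ge>n. reflect z i = reflect x' i)) \<longleftrightarrow>
      (\<exists>n<(- m). (\<forall>i\<le>n. z i = x' i) \<and> (\<forall>i\<ge>- m. z i = x i))"
    unfolding 1 by (subst ex_neg) (use 2 3 in blast)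
  then show ?thesis unfolding right_bridge_def left_bridge_def by simp
qed

lemma right_to_reflect:
  "right_to (reflect ` X) (reflect_code \<pi>) (reflect x) (reflect x') \<longleftrightarrow> left_to X \<pi> x x'"
  unfolding right_to_def left_to_def
  by (subst ex_reflect, subst all_neg) (simp add: right_bridge_reflect)

lemma right_class_closing_reflect:
  "right_class_closing (reflect ` X) (reflect_code \<pi>) \<longleftrightarrow> left_class_closing X \<pi>"
  unfolding right_class_closing_def left_class_closing_def right_equivalent_def left_equivalent_def
  by (simp add: right_to_reflect left_asymptotic_reflect)

lemma left_continuing_reflect:
  "left_continuing (reflect ` X) (reflect ` Y) (reflect_code \<pi>) \<longleftrightarrow> right_continuing X Y \<pi>"
  unfolding left_continuing_def right_continuing_def
  by (simp add: right_asymptotic_reflect)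

lemma reflect_translate: "reflect (translate c x) = translate (- c) (reflect x)"
  by (simp add: reflect_def translate_def)

context splicing_code
begin

lemma splicing_code_reflect: "splicing_code A (reflect ` X) (reflect_code \<pi>) N"
proof
  show "finite A" by (rule finite_alphabet)
  show "0 \<le> N" by (rule N_nonneg)
  show "reflect ` X \<noteq> {}" using nonempty by simp
  show "x i \<in> A" if "x \<in> reflect ` X" for x i
    using that in_alphabet by (auto simp: reflect_def)
  show "translate c x \<in> reflect ` X" if x: "x \<in> reflect ` X" for x c
  proof -
    obtain u where u: "x = reflect u" "u \<in> X" using x by blast
    have "translate c x = reflect (translate (- c) u)" by (simp add: u reflect_translate)
    then show ?thesis using translate_in[OF u(2)] by simp
  qed
  show "reflect_code \<pi> (translate c x) = translate c (reflect_code \<pi> x)"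
    if x: "x \<in> reflect ` X" for x c
  proof -
    obtain u where u: "x = reflect u" "u \<in> X" using x by blast
    have eq: "translate c (reflect u) = reflect (translate (- c) u)" by (simp add: reflect_translate)
    show ?thesis
      unfolding u(1) eq reflect_code_reflect code_translate[OF u(2)] by (simp add: reflect_translate)
  qed
  show "\<exists>z\<in>reflect ` X. \<forall>n. \<exists>k\<ge>n. \<forall>i. \<bar>i\<bar> \<le> int n \<longrightarrow> f k i = z i"
    if f: "\<And>k. f k \<in> reflect ` X" for f
  proof -
    have "reflect (f k) \<in> X" for k using f[of k] by auto
    then obtain z where z: "z \<in> X" "\<And>n. \<exists>k\<ge>n. \<forall>i. \<bar>i\<bar> \<le> int n \<longrightarrow> reflect (f k) i = z i"
      using cluster_point[of "\<lambda>k. reflect (f k)"] by blast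
    have "\<exists>k\<ge>n. \<forall>i. \<bar>i\<bar> \<le> int n \<longrightarrow> f k i = reflect z i" for n
    proof -
      obtain k where k: "k \<ge> n" "\<And>i. \<bar>i\<bar> \<le> int n \<Longrightarrow> reflect (f k) i = z i" using z(2) by blast
      have "f k i = reflect z i" if "\<bar>i\<bar> \<le> int n" for i
        using k(2)[of "- i"] that by (simp add: reflect_def)
      then show ?thesis using k(1) by blast
    qed
    then show ?thesis using z(1) by blast
  qed
  fix x x' a
  assume x: "x \<in> reflect ` X" "x' \<in> reflect ` X"
  obtain u u' where u: "x = reflect u" "u \<in> X" "x' = reflect u'" "u' \<in> X" using x by blast
  show "join x a x' \<in> reflect ` X" if eq: "\<And>i. \<bar>i - a\<bar> \<le> N \<Longrightarrow> x i = x' i"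
  proof -
    have win: "u' i = u i" if "\<bar>i - (- a)\<bar> \<le> N" for i
      using eq[of "- i"] that by (simp add: u reflect_def)
    have "join x a x' = reflect (join u' (- a) u)"
    proof
      fix i
      show "join x a x' i = reflect (join u' (- a) u) i"
        using win[of "- a"] N_nonneg by (auto simp: join_def reflect_def u)
    qed
    then show ?thesis using join_in[OF u(4,2) win] by simp
  qed
  show "reflect_code \<pi> x a = reflect_code \<pi> x' a" if eq: "\<And>i. \<bar>i - a\<bar> \<le> N \<Longrightarrow> x i = x' i"
  proof -
    have "\<pi> u (- a) = \<pi> u' (- a)"
    proof (rule code_local[OF u(2,4)])
      fix i assume "\<bar>i - (- a)\<bar> \<le> N"
      then show "u i = u' i" using eq[of "- i"] by (simp add: u reflect_def)
    qed
    then show ?thesis by (simp add: u) (simp add: reflect_def)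
  qed
  show "\<exists>z\<in>reflect ` X. \<exists>c. a < b + c \<and> (\<forall>i\<le>a. z i = x i) \<and> (\<forall>i\<ge>b + c. z i = x' (i - c))" for b
  proof -
    obtain w c where w: "w \<in> X" "- b < - a + c" "\<And>i. i \<le> - b \<Longrightarrow> w i = u' i"
      "\<And>i. i \<ge> - a + c \<Longrightarrow> w i = u (i - c)"
      using connect[OF u(4,2), of "- b" "- a"] by blast
    define z where "z = reflect (translate c w)"
    have "z \<in> reflect ` X" using translate_in[OF w(1)] by (simp add: z_def)
    moreover have "a < b + c" using w(2) by linarith
    moreover have "z i = x i" if "i \<le> a" for i
      using w(4)[of "- i + c"] that by (simp add: z_def u reflect_def translate_def)
    moreover have "z i = x' (i - c)" if "b + c \<le> i" for i
      using w(3)[of "- i + c"] that by (simp add: z_def u reflect_def translate_def)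
    ultimately show ?thesis by blast
  qed
qed

text \<open>The definition of a transition block is invariant under reversal of time, with the roles of the end
  points of the interval exchanged and all states reflected.\<close>

lemma mblocks_everywhere_reflect:
  "splicing_code.mblocks_everywhere (reflect ` X) (reflect_code \<pi>) N \<longleftrightarrow> mblocks_everywhere"
proof -
  interpret R: splicing_code A "reflect ` X" "reflect_code \<pi>" N by (rule splicing_code_reflect)
  have state: "R.state (reflect x) a = reflect (state x (- a))" for x a
  proof
    fix j show "R.state (reflect x) a j = reflect (state x (- a)) j"
      by (auto simp: state_def reflect_def restrict_def algebra_simps)
  qed
  have over: "R.over (reflect y) a b (reflect z) \<longleftrightarrow> over y (- b) (- a) z" for y a b z
  proof -
    have "(\<forall>i. a \<le> i \<and> i \<le> b \<longrightarrow> reflect (\<pi> z) i = reflect y i) \<longleftrightarrow>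
      (\<forall>i. - b \<le> i \<and> i \<le> - a \<longrightarrow> \<pi> z i = y i)"
      unfolding reflect_def by (subst all_neg) auto
    then show ?thesis by (simp add: R.over_def over_def)
  qed
  have reach: "R.reach (reflect y) a b (reflect s) (reflect t) \<longleftrightarrow> reach y (- b) (- a) t s" for y a b s t
    unfolding R.reach_def reach_def by (subst ex_reflect) (auto simp: over state)
  have tblock: "R.tblock (reflect y) a n b (reflect ` M) \<longleftrightarrow> tblock y (- b) (- n) (- a) M" for y a n b M
    unfolding R.tblock_def tblock_def
    by (subst all_reflect, subst (2) all_reflect) (auto simp: reach)
  have card: "finite (reflect ` M) \<longleftrightarrow> finite M" "card (reflect ` M) = card M" for M :: "(int \<Rightarrow> 'a) set"
    by (auto simp: inj_on_def finite_image_iff card_image)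
  have ex_image: "(\<exists>M. P M) \<longleftrightarrow> (\<exists>M. P (reflect ` M))" for P :: "(int \<Rightarrow> 'a) set \<Rightarrow> bool"
  proof
    assume "\<exists>M. P M"
    then obtain M where "P M" ..
    moreover have "reflect ` reflect ` M = M" by (simp add: image_image)
    ultimately show "\<exists>M. P (reflect ` M)" by metis
  qed blast
  have ex_block: "(\<exists>a n b M. R.tblock (reflect y) a n b M \<and> finite M \<and> card M = k) \<longleftrightarrow>
    (\<exists>a n b M. tblock y a n b M \<and> finite M \<and> card M = k)" (is "?l \<longleftrightarrow> ?r") for y k
  proof
    assume ?l
    then show ?r by (subst (asm) ex_image) (auto simp: tblock card)
  next
    assume ?r
    then obtain a n b M where "tblock y (- (- a)) (- (- n)) (- (- b)) M" "finite M" "card M = k" by auto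
    then have "R.tblock (reflect y) (- b) (- n) (- a) (reflect ` M)" by (subst tblock)
    then show ?l using \<open>finite M\<close> \<open>card M = k\<close> card by blast
  qed
  have "R.min_depth = min_depth"
    unfolding R.min_depth_def min_depth_def reflect_code_image by (simp add: ex_block)
  then show ?thesis
    unfolding R.mblocks_everywhere_def mblocks_everywhere_def R.mblock_def mblock_def
      reflect_code_image by (simp add: ex_block)
qed

theorem closing_continuing_characterization:
  "right_class_closing X \<pi> \<and> left_continuing X (\<pi> ` X) \<pi> \<longleftrightarrow>
     constant_class_to_one X (\<pi> ` X) \<pi>"
  "left_class_closing X \<pi> \<and> right_continuing X (\<pi> ` X) \<pi> \<longleftrightarrow>
     constant_class_to_one X (\<pi> ` X) \<pi>"
proof -
  show "right_class_closing X \<pi> \<and> left_continuing X (\<pi> ` X) \<pi> \<longleftrightarrow>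
     constant_class_to_one X (\<pi> ` X) \<pi>"
    using closing_continuing_iff_mblocks_everywhere constant_iff_mblocks_everywhere by blast
  interpret R: splicing_code A "reflect ` X" "reflect_code \<pi>" N by (rule splicing_code_reflect)
  show "left_class_closing X \<pi> \<and> right_continuing X (\<pi> ` X) \<pi> \<longleftrightarrow>
     constant_class_to_one X (\<pi> ` X) \<pi>"
    using R.closing_continuing_iff_mblocks_everywhere constant_iff_mblocks_everywhere
    unfolding mblocks_everywhere_reflect reflect_code_image right_class_closing_reflect
      left_continuing_reflect by blast
qed

end

section \<open>Factor codes on irreducible shifts of finite type\<close>

lemma shift_eq_translate: "shift x = translate 1 x"
  by (simp add: shift_def translate_def)

lemma translate_add: "translate c (translate d x) = translate (c + d) x"
  by (simp add: translate_def algebra_simps)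

lemma shift_space_in_alphabet:
  assumes "shift_space A X" "x \<in> X"
  shows "x i \<in> A"
proof -
  have "x \<in> topspace (full_shift_topology A)"
    using assms closedin_subset unfolding shift_space_def by blast
  then show ?thesis by (auto simp: full_shift_topology_def)
qed

lemma openin_cylinder:
  "openin (full_shift_topology A) {x. (\<forall>i. x i \<in> A) \<and> (\<forall>i. \<bar>i\<bar> \<le> int n \<longrightarrow> x i = z i)}"
proof (cases "\<forall>i. \<bar>i\<bar> \<le> int n \<longrightarrow> z i \<in> A")
  case True
  let ?S = "\<lambda>i. if \<bar>i\<bar> \<le> int n then {z i} else A"
  have "{i. ?S i \<noteq> A} \<subseteq> {- int n..int n}" by (auto split: if_splits)
  then have "finite {i. ?S i \<noteq> A}" by (rule finite_subset) simp
  moreover have "openin (discrete_topology A) (?S i)" for i using True by simp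
  ultimately have "openin (full_shift_topology A) (PiE UNIV ?S)"
    unfolding full_shift_topology_def by (subst openin_PiE_gen) auto
  moreover have "PiE UNIV ?S = {x. (\<forall>i. x i \<in> A) \<and> (\<forall>i. \<bar>i\<bar> \<le> int n \<longrightarrow> x i = z i)}"
    using True by (fastforce simp: PiE_UNIV_domain split: if_splits)
  ultimately show ?thesis by simp
next
  case False
  then obtain i where i: "\<bar>i\<bar> \<le> int n" "z i \<notin> A" by blast
  have "{x. (\<forall>i. x i \<in> A) \<and> (\<forall>i. \<bar>i\<bar> \<le> int n \<longrightarrow> x i = z i)} = {}"
    by (rule equals0I) (metis (mono_tags, lifting) i mem_Collect_eq)
  then show ?thesis by (simp only: openin_empty)
qed

lemma open_contains_cylinder:
  assumes X: "shift_space A X" and U: "openin (subtopology (full_shift_topology A) X) U" "z \<in> U"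
  shows "\<exists>n. \<forall>x\<in>X. (\<forall>i. \<bar>i\<bar> \<le> int n \<longrightarrow> x i = z i) \<longrightarrow> x \<in> U"
proof -
  obtain T where T: "openin (full_shift_topology A) T" "U = T \<inter> X"
    using U(1) by (auto simp: openin_subtopology)
  obtain V where V: "finite {i. V i \<noteq> A}" "z \<in> PiE UNIV V" "PiE UNIV V \<subseteq> T"
    using T U(2) unfolding full_shift_topology_def openin_product_topology_alt by fastforce
  define n where "n = nat (Max (insert 0 (abs ` {i. V i \<noteq> A})))"
  have n: "\<bar>i\<bar> \<le> int n" if "V i \<noteq> A" for i
  proof -
    have "\<bar>i\<bar> \<le> Max (insert 0 (abs ` {i. V i \<noteq> A}))" using V(1) that by (intro Max_ge) auto
    then show ?thesis unfolding n_def by linarith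
  qed
  have "x \<in> U" if x: "x \<in> X" "\<And>i. \<bar>i\<bar> \<le> int n \<Longrightarrow> x i = z i" for x
  proof -
    have "x i \<in> V i" for i
      using n[of i] x(2)[of i] V(2) shift_space_in_alphabet[OF X x(1), of i]
      by (cases "V i = A") (auto simp: PiE_UNIV_domain)
    then have "x \<in> PiE UNIV V" by (auto simp: PiE_UNIV_domain)
    then show ?thesis using V(3) T(2) x(1) by blast
  qed
  then show ?thesis by blast
qed

lemma shift_space_cluster_point:
  assumes X: "shift_space A X" and f: "\<And>k::nat. f k \<in> X"
  shows "\<exists>z\<in>X. \<forall>n. \<exists>k\<ge>n. \<forall>i. \<bar>i\<bar> \<le> int n \<longrightarrow> f k i = z i"
proof (rule ccontr)
  assume "\<not> ?thesis"
  then have "\<forall>z\<in>X. \<exists>n. \<forall>k\<ge>n. \<not> (\<forall>i. \<bar>i\<bar> \<le> int n \<longrightarrow> f k i = z i)" by blast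
  from bchoice[OF this] obtain m where
    m: "\<And>z k. z \<in> X \<Longrightarrow> k \<ge> m z \<Longrightarrow> \<not> (\<forall>i. \<bar>i\<bar> \<le> int (m z) \<longrightarrow> f k i = z i)"
    by blast
  define C where "C z = {x. (\<forall>i. x i \<in> A) \<and> (\<forall>i. \<bar>i\<bar> \<le> int (m z) \<longrightarrow> x i = z i)}" for z
  have "compact_space (full_shift_topology A)"
    using X unfolding full_shift_topology_def shift_space_def
    by (simp add: compact_space_product_topology compact_space_discrete_topology)
  then have "compactin (full_shift_topology A) X"
    using X closedin_compact_space unfolding shift_space_def by blast
  moreover have "\<And>U. U \<in> C ` X \<Longrightarrow> openin (full_shift_topology A) U"
    using openin_cylinder unfolding C_def by blast
  moreover have "X \<subseteq> \<Union> (C ` X)"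
    using shift_space_in_alphabet[OF X] by (auto simp: C_def)
  ultimately obtain \<F> where F: "finite \<F>" "\<F> \<subseteq> C ` X" "X \<subseteq> \<Union> \<F>"
    unfolding compactin_def by metis
  obtain Z where Z: "finite Z" "Z \<subseteq> X" "\<F> = C ` Z" using finite_subset_image[OF F(1,2)] by blast
  define k where "k = Max (insert 0 (m ` Z))"
  obtain z where z: "z \<in> Z" "f k \<in> C z" using f[of k] F(3) Z(3) by blast
  have "m z \<le> k" unfolding k_def using Z(1) z(1) by (intro Max_ge) auto
  then show False using m[of z k] z Z(2) unfolding C_def by blast
qed

lemma shift_space_translate:
  assumes "shift_space A X" "x \<in> X"
  shows "translate c x \<in> X"
proof -
  have img: "shift ` X = X" using assms(1) by (simp add: shift_space_def)
  have fwd: "translate (int n) x \<in> X" if "x \<in> X" for n x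
  proof (induction n)
    case 0
    then show ?case using that by (simp add: translate_def)
  next
    case (Suc n)
    have "translate (int (Suc n)) x = shift (translate (int n) x)"
      by (simp add: shift_eq_translate translate_add)
    then show ?case using Suc img by blast
  qed
  have bwd: "translate (- int n) x \<in> X" if "x \<in> X" for n x
  proof (induction n)
    case 0
    then show ?case using that by (simp add: translate_def)
  next
    case (Suc n)
    then obtain u where u: "u \<in> X" "translate (- int n) x = shift u" using img by blast
    have "translate (- int (Suc n)) x = translate (- 1) (translate (- int n) x)"
      by (simp add: translate_add)
    also have "\<dots> = u" by (simp add: u shift_eq_translate translate_add) (simp add: translate_def)
    finally show ?case using u by simp
  qed
  show ?thesis using fwd[OF assms(2), of "nat c"] bwd[OF assms(2), of "nat (- c)"]
    by (cases "c \<ge> 0") auto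
qed

lemma factor_code_translate:
  assumes F: "factor_code A X B Y \<pi>" and x: "x \<in> X"
  shows "\<pi> (translate c x) = translate c (\<pi> x)"
proof -
  have X: "shift_space A X" and comm: "\<And>x. x \<in> X \<Longrightarrow> \<pi> (shift x) = shift (\<pi> x)"
    using F by (auto simp: factor_code_def)
  have fwd: "\<pi> (translate (int n) x) = translate (int n) (\<pi> x)" if "x \<in> X" for n x
  proof (induction n)
    case 0
    then show ?case by (simp add: translate_def)
  next
    case (Suc n)
    have "translate (int (Suc n)) u = shift (translate (int n) u)" for u :: "int \<Rightarrow> 'c"
      by (simp add: shift_eq_translate translate_add)
    moreover have "translate (int (Suc n)) x = shift (translate (int n) x)"
      by (simp add: shift_eq_translate translate_add)
    ultimately show ?case
      using Suc comm[OF shift_space_translate[OF X that]]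
      by (simp add: shift_eq_translate translate_add)
  qed
  show ?thesis
  proof (cases "c \<ge> 0")
    case True
    then show ?thesis using fwd[OF x, of "nat c"] by simp
  next
    case False
    then have c: "int (nat (- c)) = - c" by simp
    have "translate (- c) (\<pi> (translate c x)) = \<pi> (translate (- c) (translate c x))"
      using fwd[OF shift_space_translate[OF X x, of c], of "nat (- c)"] unfolding c by simp
    also have "translate (- c) (translate c x) = x" by (simp add: translate_def)
    finally have "translate c (translate (- c) (\<pi> (translate c x))) = translate c (\<pi> x)" by simp
    then show ?thesis by (simp add: translate_def)
  qed
qed

text \<open>If no radius worked, points with different images at \<open>0\<close> but agreeing on larger and larger windows
  would cluster at a point where \<open>\<pi>\<close> is not continuous.\<close>

lemma factor_code_local:
  assumes F: "factor_code A X B Y \<pi>"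
  obtains r :: nat where "\<And>x x' a. x \<in> X \<Longrightarrow> x' \<in> X \<Longrightarrow> (\<And>i. \<bar>i - a\<bar> \<le> int r \<Longrightarrow> x i = x' i) \<Longrightarrow>
    \<pi> x a = \<pi> x' a"
proof -
  have X: "shift_space A X" and Y: "shift_space B Y" and img: "\<pi> ` X = Y"
    and cont: "continuous_map (subtopology (full_shift_topology A) X)
      (subtopology (full_shift_topology B) Y) \<pi>"
    using F by (auto simp: factor_code_def)
  have "\<exists>r::nat. \<forall>x\<in>X. \<forall>x'\<in>X. (\<forall>i. \<bar>i\<bar> \<le> int r \<longrightarrow> x i = x' i) \<longrightarrow> \<pi> x 0 = \<pi> x' 0"
  proof (rule ccontr)
    assume "\<not> ?thesis"
    then have "\<forall>r::nat. \<exists>e. fst e \<in> X \<and> snd e \<in> X \<and> (\<forall>i. \<bar>i\<bar> \<le> int r \<longrightarrow> fst e i = snd e i) \<and>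
      \<pi> (fst e) 0 \<noteq> \<pi> (snd e) 0" by simp blast
    from choice[OF this] obtain e where e: "\<And>r. fst (e r) \<in> X" "\<And>r. snd (e r) \<in> X"
      "\<And>r i. \<bar>i\<bar> \<le> int r \<Longrightarrow> fst (e r) i = snd (e r) i"
      "\<And>r. \<pi> (fst (e r)) 0 \<noteq> \<pi> (snd (e r)) 0"
      by blast
    obtain z where z: "z \<in> X" "\<And>n. \<exists>k\<ge>n. \<forall>i. \<bar>i\<bar> \<le> int n \<longrightarrow> fst (e k) i = z i"
      using shift_space_cluster_point[OF X, of "\<lambda>k. fst (e k)"] e(1) by blast
    let ?C = "{y. (\<forall>i. y i \<in> B) \<and> (\<forall>i. \<bar>i\<bar> \<le> int 0 \<longrightarrow> y i = \<pi> z i)}"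
    let ?U = "{x \<in> topspace (subtopology (full_shift_topology A) X). \<pi> x \<in> ?C \<inter> Y}"
    have "openin (subtopology (full_shift_topology B) Y) (?C \<inter> Y)"
      unfolding openin_subtopology using openin_cylinder[of B 0 "\<pi> z"] by blast
    from openin_continuous_map_preimage[OF cont this]
    have U: "openin (subtopology (full_shift_topology A) X) ?U" .
    have zU: "z \<in> ?U"
    proof -
      have "z \<in> topspace (full_shift_topology A)"
        using z(1) X closedin_subset unfolding shift_space_def by blast
      moreover have "\<pi> z \<in> Y" using img z(1) by blast
      ultimately show ?thesis using z(1) shift_space_in_alphabet[OF Y] by simp
    qed
    from open_contains_cylinder[OF X U zU] obtain n where
      "\<forall>x\<in>X. (\<forall>i. \<bar>i\<bar> \<le> int n \<longrightarrow> x i = z i) \<longrightarrow> x \<in> ?U" by blast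
    then have n: "\<pi> x 0 = \<pi> z 0" if "x \<in> X" "\<And>i. \<bar>i\<bar> \<le> int n \<Longrightarrow> x i = z i" for x
      using that by simp
    obtain k where k: "k \<ge> n" "\<And>i. \<bar>i\<bar> \<le> int n \<Longrightarrow> fst (e k) i = z i" using z(2) by blast
    have "\<pi> (fst (e k)) 0 = \<pi> z 0" using e(1) k(2) by (rule n)
    moreover have "\<pi> (snd (e k)) 0 = \<pi> z 0"
    proof (rule n[OF e(2)])
      fix i assume "\<bar>i\<bar> \<le> int n"
      then show "snd (e k) i = z i" using k e(3)[of i k] by simp
    qed
    ultimately show False using e(4)[of k] by simp
  qed
  then obtain r :: nat where r: "\<And>x x'. x \<in> X \<Longrightarrow> x' \<in> X \<Longrightarrow> (\<And>i. \<bar>i\<bar> \<le> int r \<Longrightarrow> x i = x' i) \<Longrightarrow>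
    \<pi> x 0 = \<pi> x' 0" by blast
  show ?thesis
  proof (rule that[of r])
    fix x x' a assume x: "x \<in> X" "x' \<in> X" "\<And>i. \<bar>i - a\<bar> \<le> int r \<Longrightarrow> x i = x' i"
    have "\<pi> (translate a x) 0 = \<pi> (translate a x') 0"
      by (rule r) (use x shift_space_translate[OF X] in \<open>auto simp: translate_def\<close>)
    then show "\<pi> x a = \<pi> x' a"
      unfolding factor_code_translate[OF F x(1)] factor_code_translate[OF F x(2)]
      by (simp add: translate_def)
  qed
qed

definition window :: "(int \<Rightarrow> 'a) \<Rightarrow> int \<Rightarrow> nat \<Rightarrow> 'a list" where
  "window x i n = map (\<lambda>j. x (i + int j)) [0..<n]"

lemma length_window [simp]: "length (window x i n) = n"
  by (simp add: window_def)

lemma nth_window [simp]: "j < n \<Longrightarrow> window x i n ! j = x (i + int j)"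
  by (simp add: window_def)

lemma language_eq_windows: "language X = {window x i n |x i n. x \<in> X}"
  by (simp add: language_def window_def)

lemma window_in_language: "x \<in> X \<Longrightarrow> window x i n \<in> language X"
  unfolding language_eq_windows by blast

lemma window_append: "window x i m @ window x (i + int m) n = window x i (m + n)"
  by (rule nth_equalityI) (auto simp: nth_append algebra_simps of_nat_diff)

lemma window_cong:
  "(\<And>j. i \<le> j \<Longrightarrow> j < i + int n \<Longrightarrow> x j = x' j) \<Longrightarrow> window x i n = window x' i n"
  by (simp add: window_def)

lemma language_realized_at:
  assumes X: "shift_space A X" and w: "w \<in> language X"
  obtains x where "x \<in> X" "\<And>j. j < length w \<Longrightarrow> x (a + int j) = w ! j"
proof -
  obtain x i n where x: "x \<in> X" "w = window x i n" using w unfolding language_eq_windows by blast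
  show ?thesis
  proof (rule that[of "translate (i - a) x"])
    show "translate (i - a) x \<in> X" by (rule shift_space_translate[OF X x(1)])
    show "translate (i - a) x (a + int j) = w ! j" if "j < length w" for j
      using that by (simp add: x(2) translate_def algebra_simps)
  qed
qed

text \<open>On every finite window the spliced sequence is a word \<open>u @ w @ v\<close> where \<open>u @ w\<close> comes from \<open>x\<close> and
  \<open>w @ v\<close> from \<open>x'\<close>, so it belongs to the language; closedness of \<open>X\<close> does the rest.\<close>

lemma finite_type_join:
  assumes S: "shift_of_finite_type A X"
  obtains k :: nat where "\<And>x x' a N. x \<in> X \<Longrightarrow> x' \<in> X \<Longrightarrow> int k \<le> N \<Longrightarrow>
    (\<And>i. \<bar>i - a\<bar> \<le> N \<Longrightarrow> x i = x' i) \<Longrightarrow> join x a x' \<in> X"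
proof -
  have X: "shift_space A X" using S by (simp add: shift_of_finite_type_def)
  obtain k where k: "\<And>w u v. w \<in> language X \<Longrightarrow> length w = k \<Longrightarrow> u @ w \<in> language X \<Longrightarrow>
      w @ v \<in> language X \<Longrightarrow> u @ w @ v \<in> language X"
    using S unfolding shift_of_finite_type_def by blast
  show ?thesis
  proof (rule that[of k])
    fix x x' a N
    assume x: "x \<in> X" "x' \<in> X" and N: "int k \<le> N" and eq: "\<And>i. \<bar>i - a\<bar> \<le> N \<Longrightarrow> x i = x' i"
    define J where "J = join x a x'"
    have l: "J i = x i" if "i \<le> a + N" for i
      using eq[of i] that unfolding J_def join_def by auto
    have r: "J i = x' i" if "a - N \<le> i" for i
      using eq[of i] that unfolding J_def join_def by auto
    have "\<forall>n::nat. \<exists>z. z \<in> X \<and> (\<forall>i. a - N - int n \<le> i \<and> i < a - N + int k + int n \<longrightarrow> z i = J i)"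
    proof
      fix n :: nat
      let ?u = "window J (a - N - int n) n" and ?w = "window J (a - N) k"
        and ?v = "window J (a - N + int k) n"
      have uw: "?u @ ?w = window J (a - N - int n) (n + k)"
        using window_append[of J "a - N - int n" n k] by simp
      have wv: "?w @ ?v = window J (a - N) (k + n)" by (rule window_append)
      have uwv: "?u @ ?w @ ?v = window J (a - N - int n) (n + (k + n))"
        unfolding wv using window_append[of J "a - N - int n" n "k + n"] by simp
      have "?w = window x (a - N) k" by (rule window_cong, rule l) (use N in linarith)
      then have w: "?w \<in> language X" using window_in_language[OF x(1)] by simp
      have "window J (a - N - int n) (n + k) = window x (a - N - int n) (n + k)"
        by (rule window_cong, rule l) (use N in linarith)
      then have "?u @ ?w \<in> language X" unfolding uw using window_in_language[OF x(1)] by simp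
      moreover have "window J (a - N) (k + n) = window x' (a - N) (k + n)"
        by (rule window_cong, rule r)
      then have "?w @ ?v \<in> language X" unfolding wv using window_in_language[OF x(2)] by simp
      ultimately have "?u @ ?w @ ?v \<in> language X" using k[OF w] by simp
      then have "window J (a - N - int n) (n + (k + n)) \<in> language X" by (simp only: uwv)
      then obtain z where z: "z \<in> X" "\<And>j. j < n + (k + n) \<Longrightarrow> z (a - N - int n + int j) = J (a - N - int n + int j)"
        using language_realized_at[OF X, of _ "a - N - int n"] by (metis length_window nth_window)
      have "z i = J i" if "a - N - int n \<le> i" "i < a - N + int k + int n" for i
      proof -
        have "int (nat (i - (a - N - int n))) = i - (a - N - int n)" using that by simp
        moreover have "nat (i - (a - N - int n)) < n + (k + n)" using that by linarith
        ultimately show ?thesis using z(2)[of "nat (i - (a - N - int n))"] by simp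
      qed
      then show "\<exists>z. z \<in> X \<and> (\<forall>i. a - N - int n \<le> i \<and> i < a - N + int k + int n \<longrightarrow> z i = J i)"
        using z(1) by blast
    qed
    from choice[OF this] obtain f where f: "\<And>n. f n \<in> X"
      "\<And>n i. a - N - int n \<le> i \<Longrightarrow> i < a - N + int k + int n \<Longrightarrow> f n i = J i"
      by blast
    obtain z where z: "z \<in> X" "\<And>n. \<exists>k\<ge>n. \<forall>i. \<bar>i\<bar> \<le> int n \<longrightarrow> f k i = z i"
      using shift_space_cluster_point[OF X, of f] f(1) by blast
    have "z i = J i" for i
    proof -
      obtain n where n: "n \<ge> nat (\<bar>i\<bar> + \<bar>a - N\<bar> + 1)" "f n i = z i"
        using z(2)[of "nat (\<bar>i\<bar> + \<bar>a - N\<bar> + 1)"] by auto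
      moreover have "a - N - int n \<le> i" "i < a - N + int k + int n" using n(1) by linarith+
      ultimately show ?thesis using f(2)[of n i] by simp
    qed
    then have "z = J" by blast
    then show "join x a x' \<in> X" using z(1) by (simp add: J_def)
  qed
qed

text \<open>Irreducibility joins the states of \<open>x\<close> at \<open>a\<close> and of \<open>x'\<close> at \<open>b\<close> by a word; splicing at both states
  attaches the left ray of \<open>x\<close> and the right ray of \<open>x'\<close>.\<close>

lemma irreducible_connect:
  assumes X: "shift_space A X" and irr: "irreducible_shift X" and N: "N \<ge> 0"
    and join: "\<And>x x' a. x \<in> X \<Longrightarrow> x' \<in> X \<Longrightarrow> (\<And>i. \<bar>i - a\<bar> \<le> N \<Longrightarrow> x i = x' i) \<Longrightarrow> join x a x' \<in> X"
    and x: "x \<in> X" "x' \<in> X"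
  shows "\<exists>z\<in>X. \<exists>c. a < b + c \<and> (\<forall>i\<le>a. z i = x i) \<and> (\<forall>i\<ge>b + c. z i = x' (i - c))"
proof -
  define l where "l = nat (2 * N + 1)"
  have l: "int l = 2 * N + 1" using N by (simp add: l_def)
  let ?u = "window x (a - N) l" and ?v = "window x' (b - N) l"
  obtain w where w: "?u @ w @ ?v \<in> language X"
    using irr window_in_language x unfolding irreducible_shift_def by blast
  obtain y where y: "y \<in> X" "\<And>j. j < length (?u @ w @ ?v) \<Longrightarrow> y (a - N + int j) = (?u @ w @ ?v) ! j"
    using language_realized_at[OF X w] by metis
  define c where "c = a - b + int l + int (length w)"
  have yx: "x i = y i" if "\<bar>i - a\<bar> \<le> N" for i
  proof -
    define j where "j = nat (i - (a - N))"
    have j: "int j = i - (a - N)" "j < l" using that l unfolding j_def by linarith+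
    then show ?thesis using y(2)[of j] by (simp add: nth_append)
  qed
  have yx': "y i = translate (- c) x' i" if "\<bar>i - (b + c)\<bar> \<le> N" for i
  proof -
    define j where "j = nat (i - (b + c - N))"
    have j: "int j = i - (b + c - N)" "j < l" using that l unfolding j_def by linarith+
    have "(?u @ w @ ?v) ! (l + (length w + j)) = x' (b - N + int j)"
      using j(2) by (simp add: nth_append)
    moreover have "a - N + int (l + (length w + j)) = i" using j(1) by (simp add: c_def)
    ultimately have "y i = x' (b - N + int j)" using y(2)[of "l + (length w + j)"] j(2) by simp
    then show ?thesis using j(1) by (simp add: translate_def)
  qed
  have ac: "a < b + c" using l N unfolding c_def by linarith
  have J1: "join x a y \<in> X" using x(1) y(1) yx by (rule join)
  define z where "z = join (join x a y) (b + c) (translate (- c) x')"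
  have z: "z \<in> X" unfolding z_def
  proof (rule join[OF J1 shift_space_translate[OF X x(2)]])
    fix i assume i: "\<bar>i - (b + c)\<bar> \<le> N"
    then have "a < i" using l N unfolding c_def by linarith
    then show "join x a y i = translate (- c) x' i" using yx'[OF i] by (simp add: join_def)
  qed
  have "z i = x i" if "i \<le> a" for i using that ac by (simp add: z_def join_def)
  moreover have "z i = x' (i - c)" if "b + c \<le> i" for i
    using that ac yx'[of "b + c"] N by (cases "i = b + c") (auto simp: z_def join_def translate_def)
  ultimately show ?thesis using z ac by blast
qed

lemma splicing_code_of_factor_code:
  assumes "shift_of_finite_type A X" "irreducible_shift X" "factor_code A X B Y \<pi>" "X \<noteq> {}"
  shows "\<exists>N. splicing_code A X \<pi> N"
proof -
  have X: "shift_space A X" using assms(1) by (simp add: shift_of_finite_type_def)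
  obtain k where k: "\<And>x x' a N. x \<in> X \<Longrightarrow> x' \<in> X \<Longrightarrow> int k \<le> N \<Longrightarrow>
    (\<And>i. \<bar>i - a\<bar> \<le> N \<Longrightarrow> x i = x' i) \<Longrightarrow> join x a x' \<in> X"
    using finite_type_join[OF assms(1)] by blast
  obtain r where r: "\<And>x x' a. x \<in> X \<Longrightarrow> x' \<in> X \<Longrightarrow> (\<And>i. \<bar>i - a\<bar> \<le> int r \<Longrightarrow> x i = x' i) \<Longrightarrow>
    \<pi> x a = \<pi> x' a"
    using factor_code_local[OF assms(3)] by blast
  define N where "N = int (max k r)"
  have N0: "N \<ge> 0" by (simp add: N_def)
  have join: "join x a x' \<in> X" if "x \<in> X" "x' \<in> X" "\<And>i. \<bar>i - a\<bar> \<le> N \<Longrightarrow> x i = x' i" for x x' a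
    using that by (intro k[of _ _ N]) (auto simp: N_def)
  have "splicing_code A X \<pi> N"
  proof
    show "finite A" using X by (simp add: shift_space_def)
    show "0 \<le> N" by (rule N0)
    fix x assume x: "x \<in> X"
    show "x i \<in> A" for i using shift_space_in_alphabet[OF X x] .
    show "translate c x \<in> X" for c using shift_space_translate[OF X x] .
    show "\<pi> (translate c x) = translate c (\<pi> x)" for c using factor_code_translate[OF assms(3) x] .
    fix x' assume x': "x' \<in> X"
    fix a
    show "\<exists>z\<in>X. \<exists>c. a < b + c \<and> (\<forall>i\<le>a. z i = x i) \<and> (\<forall>i\<ge>b + c. z i = x' (i - c))" for b
      by (rule irreducible_connect[OF X assms(2) N0 _ x x']) (rule join)
    assume eq: "\<And>i. \<bar>i - a\<bar> \<le> N \<Longrightarrow> x i = x' i"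
    show "join x a x' \<in> X" using x x' eq by (rule join)
    show "\<pi> x a = \<pi> x' a" by (rule r[OF x x'], rule eq) (simp add: N_def)
  qed (use assms(4) shift_space_cluster_point[OF X] in auto)
  then show ?thesis ..
qed

theorem theorem5p6:
  fixes A :: "'a set" and X :: "(int \<Rightarrow> 'a) set"
    and B :: "'b set" and Y :: "(int \<Rightarrow> 'b) set"
    and \<pi> :: "(int \<Rightarrow> 'a) \<Rightarrow> (int \<Rightarrow> 'b)"
  assumes "shift_of_finite_type A X"
    and "irreducible_shift X"
    and "sofic_shift B Y"
    and "factor_code A X B Y \<pi>"
  shows "(right_class_closing X \<pi> \<and> left_continuing X Y \<pi> \<longleftrightarrow>
            left_class_closing X \<pi> \<and> right_continuing X Y \<pi>) \<and>
         (left_class_closing X \<pi> \<and> right_continuing X Y \<pi> \<longleftrightarrow>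
            constant_class_to_one X Y \<pi>)"
proof -
  have Y: "Y = \<pi> ` X" using assms(4) by (simp add: factor_code_def)
  show ?thesis
  proof (cases "X = {}")
    case True
    then show ?thesis
      by (simp add: Y right_class_closing_def left_class_closing_def left_continuing_def
          right_continuing_def constant_class_to_one_def)
  next
    case False
    then obtain N where "splicing_code A X \<pi> N"
      using splicing_code_of_factor_code[OF assms(1,2,4)] by blast
    then show ?thesis
      unfolding Y using splicing_code.closing_continuing_characterization by blast
  qed
qed

end
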